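(* Let $\tau$ be an arithmetic signature. Then for every $\tau$-formula $\phi$ in negation normal form, which may contain both weak existential and weak universal quantifiers, there is a $\tau$-formula $\phi'$ such that (1) $\phi'$ is equivalent to $\phi$ on finite structures, (2) $\mathrm{qr}(\phi') = 3\cdot \mathrm{strong\text{-}qr}(\phi) + O(\mathrm{arity}(\tau))$, and (3) $|\mathrm{bound}(\phi')| = |\mathrm{strong\text{-}bound}(\phi)| + O(\mathrm{arity}(\tau))$, where neither weak existential nor weak universal quantifiers count towards $\mathrm{strong\text{-}qr}(\phi)$, and variables bound by them do not belong to $\mathrm{strong\text{-}bound}(\phi)$.
   Context: A signature $\tau$ is arithmetic if it contains $<$, ternary $\mathrm{add}$, ternary $\mathrm{mult}$, unary function $\mathrm{succ}$ and constant $0$; $\mathrm{STRUC}[\tau]$ contains only finite $\tau$-structures in which $<$ is a linear order and $\mathrm{add},\mathrm{mult},\mathrm{succ},0$ have their natural meaning relative to it. $\mathrm{arity}(\tau)$ is the maximum arity of a relation symbol in $\tau$. Negation normal form: negations only applied to atoms; $x\neq y$ abbreviates $\neg\, x=y$. For a subformula $\forall d(\psi)$ or $\exists d(\psi)$, $d$ depends on all variables free in $\psi$. The leading quantifier of $\exists x(\psi)$ is weak unless (i) some universal quantifier binding inside $\psi$ depends on $x$, or (ii) there is a subformula $\alpha\land\beta$ of $\psi$ with both $\alpha$ and $\beta$ containing $x$ in literals not of the form $x\neq y$ for a variable $y$. Dually, the leading quantifier of $\forall x(\psi)$ is weak if no existential quantifier binding inside $\psi$ depends on $x$ and for every subformula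 $\alpha\lor\beta$ of $\psi$ at most one of $\alpha,\beta$ contains a literal that contains $x$ and is not of the form $x = y$ for a variable $y$. Quantifiers that are not weak are strong. $\mathrm{qr}$ is quantifier rank, $\mathrm{bound}(\phi)$ the set of bound variables, $\mathrm{strong\text{-}qr}(\phi)$ the quantifier rank ignoring weak quantifiers, $\mathrm{strong\text{-}bound}(\phi)$ the set of variables bound by strong quantifiers. $O(\mathrm{arity}(\tau))$ denotes a quantity bounded by $c\cdot\mathrm{arity}(\tau)+c$ for an absolute constant $c$. *)

theory Defs
  imports Main
begin

text \<open>Variables, relation symbols and constant symbols are natural numbers.
  The arithmetic symbols (order, ternary add, ternary mult, the unary function
  succ and the constant 0) are built into the syntax, so every signature is
  arithmetic.\<close>

datatype trm = V nat | Zero | Succ trm | Cst nat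

datatype atom =
    Eq trm trm
  | Lt trm trm
  | Add trm trm trm
  | Mult trm trm trm
  | Rel nat "trm list"

datatype fm =
    Atom atom
  | Neg fm
  | Conj fm fm
  | Disj fm fm
  | Ex nat fm
  | All nat fm

text \<open>A signature: its (extra) relation symbols with their arities and its
  (extra) constant symbols.  The arithmetic symbols are always present.\<close>

record sig =
  srels :: "nat set"
  sar :: "nat \<Rightarrow> nat"
  sconsts :: "nat set"

text \<open>Maximal arity of a relation symbol, including < (2), add and mult (3).\<close>
definition arity :: "sig \<Rightarrow> nat" where
  "arity \<tau> = Max (insert 2 (insert 3 (sar \<tau> ` srels \<tau>)))"

fun wf_trm :: "sig \<Rightarrow> trm \<Rightarrow> bool" where
  "wf_trm \<tau> (V x) = True"
| "wf_trm \<tau> Zero = True"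
| "wf_trm \<tau> (Succ t) = wf_trm \<tau> t"
| "wf_trm \<tau> (Cst c) = (c \<in> sconsts \<tau>)"

fun wf_atom :: "sig \<Rightarrow> atom \<Rightarrow> bool" where
  "wf_atom \<tau> (Eq s t) = (wf_trm \<tau> s \<and> wf_trm \<tau> t)"
| "wf_atom \<tau> (Lt s t) = (wf_trm \<tau> s \<and> wf_trm \<tau> t)"
| "wf_atom \<tau> (Add s t u) = (wf_trm \<tau> s \<and> wf_trm \<tau> t \<and> wf_trm \<tau> u)"
| "wf_atom \<tau> (Mult s t u) = (wf_trm \<tau> s \<and> wf_trm \<tau> t \<and> wf_trm \<tau> u)"
| "wf_atom \<tau> (Rel r ts) =
     (r \<in> srels \<tau> \<and> length ts = sar \<tau> r \<and> (\<forall>t\<in>set ts. wf_trm \<tau> t))"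

fun wf_fm :: "sig \<Rightarrow> fm \<Rightarrow> bool" where
  "wf_fm \<tau> (Atom a) = wf_atom \<tau> a"
| "wf_fm \<tau> (Neg \<phi>) = wf_fm \<tau> \<phi>"
| "wf_fm \<tau> (Conj \<phi> \<psi>) = (wf_fm \<tau> \<phi> \<and> wf_fm \<tau> \<psi>)"
| "wf_fm \<tau> (Disj \<phi> \<psi>) = (wf_fm \<tau> \<phi> \<and> wf_fm \<tau> \<psi>)"
| "wf_fm \<tau> (Ex x \<phi>) = wf_fm \<tau> \<phi>"
| "wf_fm \<tau> (All x \<phi>) = wf_fm \<tau> \<phi>"

text \<open>A finite arithmetic structure of size n (n \<ge> 1) is taken, up to
  isomorphism, to have universe {0..<n} with the natural order; add and mult
  are the graphs of + and *, 0 is 0, and succ x = x + 1 except that the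
  maximal element is mapped to itself.  rI interprets the extra relation
  symbols, cI the extra constants.\<close>

fun eval_trm :: "nat \<Rightarrow> (nat \<Rightarrow> nat) \<Rightarrow> (nat \<Rightarrow> nat) \<Rightarrow> trm \<Rightarrow> nat" where
  "eval_trm n cI e (V x) = e x"
| "eval_trm n cI e Zero = 0"
| "eval_trm n cI e (Succ t) = min (eval_trm n cI e t + 1) (n - 1)"
| "eval_trm n cI e (Cst c) = cI c"

fun sat_atom :: "nat \<Rightarrow> (nat \<Rightarrow> nat list \<Rightarrow> bool) \<Rightarrow> (nat \<Rightarrow> nat) \<Rightarrow> (nat \<Rightarrow> nat) \<Rightarrow> atom \<Rightarrow> bool" where
  "sat_atom n rI cI e (Eq s t) = (eval_trm n cI e s = eval_trm n cI e t)"
| "sat_atom n rI cI e (Lt s t) = (eval_trm n cI e s < eval_trm n cI e t)"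
| "sat_atom n rI cI e (Add s t u) = (eval_trm n cI e s + eval_trm n cI e t = eval_trm n cI e u)"
| "sat_atom n rI cI e (Mult s t u) = (eval_trm n cI e s * eval_trm n cI e t = eval_trm n cI e u)"
| "sat_atom n rI cI e (Rel r ts) = rI r (map (eval_trm n cI e) ts)"

fun sat :: "nat \<Rightarrow> (nat \<Rightarrow> nat list \<Rightarrow> bool) \<Rightarrow> (nat \<Rightarrow> nat) \<Rightarrow> (nat \<Rightarrow> nat) \<Rightarrow> fm \<Rightarrow> bool" where
  "sat n rI cI e (Atom a) = sat_atom n rI cI e a"
| "sat n rI cI e (Neg \<phi>) = (\<not> sat n rI cI e \<phi>)"
| "sat n rI cI e (Conj \<phi> \<psi>) = (sat n rI cI e \<phi> \<and> sat n rI cI e \<psi>)"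
| "sat n rI cI e (Disj \<phi> \<psi>) = (sat n rI cI e \<phi> \<or> sat n rI cI e \<psi>)"
| "sat n rI cI e (Ex x \<phi>) = (\<exists>a<n. sat n rI cI (e(x := a)) \<phi>)"
| "sat n rI cI e (All x \<phi>) = (\<forall>a<n. sat n rI cI (e(x := a)) \<phi>)"

definition is_struc :: "sig \<Rightarrow> nat \<Rightarrow> (nat \<Rightarrow> nat) \<Rightarrow> bool" where
  "is_struc \<tau> n cI \<longleftrightarrow> 1 \<le> n \<and> (\<forall>c\<in>sconsts \<tau>. cI c < n)"

definition equiv_fin :: "sig \<Rightarrow> fm \<Rightarrow> fm \<Rightarrow> bool" where
  "equiv_fin \<tau> \<phi> \<psi> \<longleftrightarrow>
     (\<forall>n rI cI e. is_struc \<tau> n cI \<and> (\<forall>v. e v < n) \<longrightarrow>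
        (sat n rI cI e \<phi> \<longleftrightarrow> sat n rI cI e \<psi>))"

fun vars_trm :: "trm \<Rightarrow> nat set" where
  "vars_trm (V x) = {x}"
| "vars_trm Zero = {}"
| "vars_trm (Succ t) = vars_trm t"
| "vars_trm (Cst c) = {}"

fun vars_atom :: "atom \<Rightarrow> nat set" where
  "vars_atom (Eq s t) = vars_trm s \<union> vars_trm t"
| "vars_atom (Lt s t) = vars_trm s \<union> vars_trm t"
| "vars_atom (Add s t u) = vars_trm s \<union> vars_trm t \<union> vars_trm u"
| "vars_atom (Mult s t u) = vars_trm s \<union> vars_trm t \<union> vars_trm u"
| "vars_atom (Rel r ts) = (\<Union>t\<in>set ts. vars_trm t)"

fun fv :: "fm \<Rightarrow> nat set" where
  "fv (Atom a) = vars_atom a"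
| "fv (Neg \<phi>) = fv \<phi>"
| "fv (Conj \<phi> \<psi>) = fv \<phi> \<union> fv \<psi>"
| "fv (Disj \<phi> \<psi>) = fv \<phi> \<union> fv \<psi>"
| "fv (Ex x \<phi>) = fv \<phi> - {x}"
| "fv (All x \<phi>) = fv \<phi> - {x}"

fun nnf :: "fm \<Rightarrow> bool" where
  "nnf (Atom a) = True"
| "nnf (Neg (Atom a)) = True"
| "nnf (Neg \<phi>) = False"
| "nnf (Conj \<phi> \<psi>) = (nnf \<phi> \<and> nnf \<psi>)"
| "nnf (Disj \<phi> \<psi>) = (nnf \<phi> \<and> nnf \<psi>)"
| "nnf (Ex x \<phi>) = nnf \<phi>"
| "nnf (All x \<phi>) = nnf \<phi>"

fun subfms :: "fm \<Rightarrow> fm set" where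
  "subfms (Atom a) = {Atom a}"
| "subfms (Neg \<phi>) = insert (Neg \<phi>) (subfms \<phi>)"
| "subfms (Conj \<phi> \<psi>) = insert (Conj \<phi> \<psi>) (subfms \<phi> \<union> subfms \<psi>)"
| "subfms (Disj \<phi> \<psi>) = insert (Disj \<phi> \<psi>) (subfms \<phi> \<union> subfms \<psi>)"
| "subfms (Ex x \<phi>) = insert (Ex x \<phi>) (subfms \<phi>)"
| "subfms (All x \<phi>) = insert (All x \<phi>) (subfms \<phi>)"

fun lits :: "fm \<Rightarrow> fm set" where
  "lits (Atom a) = {Atom a}"
| "lits (Neg (Atom a)) = {Neg (Atom a)}"
| "lits (Neg \<phi>) = lits \<phi>"
| "lits (Conj \<phi> \<psi>) = lits \<phi> \<union> lits \<psi>"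
| "lits (Disj \<phi> \<psi>) = lits \<phi> \<union> lits \<psi>"
| "lits (Ex x \<phi>) = lits \<phi>"
| "lits (All x \<phi>) = lits \<phi>"

fun lit_vars :: "fm \<Rightarrow> nat set" where
  "lit_vars (Atom a) = vars_atom a"
| "lit_vars (Neg (Atom a)) = vars_atom a"
| "lit_vars _ = {}"

definition is_neq_var :: "nat \<Rightarrow> fm \<Rightarrow> bool" where
  "is_neq_var x L \<longleftrightarrow> (\<exists>y. L = Neg (Atom (Eq (V x) (V y))) \<or> L = Neg (Atom (Eq (V y) (V x))))"

definition is_eq_var :: "nat \<Rightarrow> fm \<Rightarrow> bool" where
  "is_eq_var x L \<longleftrightarrow> (\<exists>y. L = Atom (Eq (V x) (V y)) \<or> L = Atom (Eq (V y) (V x)))"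

text \<open>Weakness of the leading quantifier of Ex x \<psi> and of All x \<psi>.
  A quantifier Q d (\<chi>) depends on x iff x is free in \<chi>.\<close>
definition weak_ex :: "nat \<Rightarrow> fm \<Rightarrow> bool" where
  "weak_ex x \<psi> \<longleftrightarrow>
     \<not> (\<exists>d \<chi>. All d \<chi> \<in> subfms \<psi> \<and> x \<in> fv \<chi>) \<and>
     \<not> (\<exists>\<alpha> \<beta>. Conj \<alpha> \<beta> \<in> subfms \<psi> \<and>
            (\<exists>L\<in>lits \<alpha>. x \<in> lit_vars L \<and> \<not> is_neq_var x L) \<and>
            (\<exists>L\<in>lits \<beta>. x \<in> lit_vars L \<and> \<not> is_neq_var x L))"

definition weak_all :: "nat \<Rightarrow> fm \<Rightarrow> bool" where
  "weak_all x \<psi> \<longleftrightarrow>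
     \<not> (\<exists>d \<chi>. Ex d \<chi> \<in> subfms \<psi> \<and> x \<in> fv \<chi>) \<and>
     (\<forall>\<alpha> \<beta>. Disj \<alpha> \<beta> \<in> subfms \<psi> \<longrightarrow>
            \<not> ((\<exists>L\<in>lits \<alpha>. x \<in> lit_vars L \<and> \<not> is_eq_var x L) \<and>
               (\<exists>L\<in>lits \<beta>. x \<in> lit_vars L \<and> \<not> is_eq_var x L)))"

fun qr :: "fm \<Rightarrow> nat" where
  "qr (Atom a) = 0"
| "qr (Neg \<phi>) = qr \<phi>"
| "qr (Conj \<phi> \<psi>) = max (qr \<phi>) (qr \<psi>)"
| "qr (Disj \<phi> \<psi>) = max (qr \<phi>) (qr \<psi>)"
| "qr (Ex x \<phi>) = qr \<phi> + 1"
| "qr (All x \<phi>) = qr \<phi> + 1"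

fun bound :: "fm \<Rightarrow> nat set" where
  "bound (Atom a) = {}"
| "bound (Neg \<phi>) = bound \<phi>"
| "bound (Conj \<phi> \<psi>) = bound \<phi> \<union> bound \<psi>"
| "bound (Disj \<phi> \<psi>) = bound \<phi> \<union> bound \<psi>"
| "bound (Ex x \<phi>) = insert x (bound \<phi>)"
| "bound (All x \<phi>) = insert x (bound \<phi>)"

fun strong_qr :: "fm \<Rightarrow> nat" where
  "strong_qr (Atom a) = 0"
| "strong_qr (Neg \<phi>) = strong_qr \<phi>"
| "strong_qr (Conj \<phi> \<psi>) = max (strong_qr \<phi>) (strong_qr \<psi>)"
| "strong_qr (Disj \<phi> \<psi>) = max (strong_qr \<phi>) (strong_qr \<psi>)"
| "strong_qr (Ex x \<phi>) = (if weak_ex x \<phi> then strong_qr \<phi> else strong_qr \<phi> + 1)"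
| "strong_qr (All x \<phi>) = (if weak_all x \<phi> then strong_qr \<phi> else strong_qr \<phi> + 1)"

fun strong_bound :: "fm \<Rightarrow> nat set" where
  "strong_bound (Atom a) = {}"
| "strong_bound (Neg \<phi>) = strong_bound \<phi>"
| "strong_bound (Conj \<phi> \<psi>) = strong_bound \<phi> \<union> strong_bound \<psi>"
| "strong_bound (Disj \<phi> \<psi>) = strong_bound \<phi> \<union> strong_bound \<psi>"
| "strong_bound (Ex x \<phi>) = (if weak_ex x \<phi> then strong_bound \<phi> else insert x (strong_bound \<phi>))"
| "strong_bound (All x \<phi>) = (if weak_all x \<phi> then strong_bound \<phi> else insert x (strong_bound \<phi>))"

end

theory Submission
  imports Defs "HOL-Real_Asymp.Real_Asymp" "HOL-Number_Theory.Cong" "HOL-Library.Discrete_Functions"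
    "HOL-Library.Infinite_Set"
begin

text \<open>Weak existential quantifiers are removed by colour coding. Each weak variable of an
  existential block gets a colour class of its own. The inequality of a weak variable with another
  variable then becomes a statement about colour classes, so that in every conjunction a
  weak variable occurs on one side only and its quantifier can be pushed down to a single literal,
  where at most arity many variables have to be bound. The colour classes are definable
  from two elements q and a: some q of size polylogarithmic in n is injective modulo q on
  the finitely many relevant elements, because lcm(1, ..., m + 1) is at least 2 to the power m; the
  residues of the colours are encoded in a by the Chinese remainder theorem, with the moduli
  (i + 1) * k! * q + 1 of the Goedel beta function. So a block costs two quantifiers.

  Universal subformulas that are not below a strong quantifier of their block depend on no
  variable bound in the block and are pulled out of it. Hence on every path each block except the
  outermost is entered below a strong quantifier, which can be charged for q and a: this is
  the factor 3. Universal blocks are treated by duality, and small structures by writing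
  their elements as numerals.\<close>

text \<open>A block contains existential quantifiers only, and this bounds the number of elements a
  colouring has to separate: one satisfying choice of witnesses meets at most two elements per
  inequality literal, however large the structure is. Below a universal quantifier every instance
  would bring its own inequalities, so a block must stop there. Taking a universal subformula out of
  a block is no syntactic rewriting, since it sits among conjunctions and disjunctions. The
  translation guesses the set of those that hold, asserts their translations beside the block and
  puts truth constants in their places. Negation normal form makes the block monotone in them, so a
  guess that is too small does no harm. The two directions are asymmetric. Soundness works for
  arbitrary \<open>q\<close> and \<open>a\<close>, as long as the colour classes in use are
  nonempty; only completeness needs the number theory. All translations share one window of
  \<open>arity \<tau> + 6\<close> fresh variables, whatever the nesting. This is harmless because
  the truth of a translation depends only on the free variables of the original formula, which lie
  outside the window.\<close>

subsection \<open>Colouring few elements with two parameters\<close>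

text \<open>Divisibility is inherited along the Leibniz harmonic triangle: its entries
  1 / ((n + 1) * (n choose j)) are differences of neighbouring entries, starting from the
  column 1 / (n + 1).\<close>

lemma leibniz_triangle_Lcm:
  fixes n j m :: nat
  assumes "j \<le> n" "n < m"
  shows "Suc n * (n choose j) dvd Lcm {1..m}"
proof -
  let ?L = "Lcm {1..m}"
  \<comment> \<open>The multiplier is an integer because the induction step subtracts two
    multipliers.\<close>
  have "\<exists>z::int. z * (int (Suc n) * int (n choose j)) = int ?L"
    using assms
  proof (induction j arbitrary: n)
    case 0
    then have "Suc n dvd ?L" by (intro dvd_Lcm) auto
    then have "int (Suc n) dvd int ?L" using of_nat_dvd_iff by blast
    then show ?case by (metis binomial_n_0 dvd_def mult.commute mult.right_neutral of_nat_1)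
  next
    case (Suc j)
    then obtain n' where n: "n = Suc n'" by (cases n) auto
    from Suc.IH[of n'] Suc.prems n obtain u where u: "u * (int (Suc n') * int (n' choose j)) = int ?L" by auto
    from Suc.IH[of n] Suc.prems n obtain w where w: "w * (int (Suc n) * int (n choose j)) = int ?L" by auto
    have a: "int (Suc j) * int (n choose Suc j) = int (Suc n') * int (n' choose j)"
      using Suc_times_binomial_eq[of n' j] n by (metis of_nat_mult mult.commute)
    have "Suc j * (n choose Suc j) = (n - j) * (n choose j)"
      by (metis binomial_absorb_comp binomial_absorption n diff_Suc_1)
    then have b: "int (Suc j) * int (n choose Suc j) = (int n - int j) * int (n choose j)"
      using Suc.prems by (metis Suc_leD of_nat_diff of_nat_mult)
    let ?x = "int (Suc n) * int (n choose Suc j)"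
    \<comment> \<open>The difference rule of the triangle, scaled by the lcm and cleared of
      denominators by the factor \<open>Suc j\<close>.\<close>
    have "int (Suc j) * ((u - w) * ?x) = int (Suc n) * u * (int (Suc j) * int (n choose Suc j)) - w * int (Suc n) * (int (Suc j) * int (n choose Suc j))"
      by (simp add: algebra_simps)
    also have "\<dots> = int (Suc n) * (u * (int (Suc n') * int (n' choose j))) - (int n - int j) * (w * (int (Suc n) * int (n choose j)))"
      unfolding a b[unfolded a] by (simp add: algebra_simps)
    also have "\<dots> = int (Suc j) * int ?L" unfolding u w by (simp add: algebra_simps)
    finally have "(u - w) * ?x = int ?L" by (metis mult_left_cancel of_nat_eq_0_iff nat.distinct(1))
    then show ?case by blast
  qed
  then have "int (Suc n * (n choose j)) dvd int ?L" by (metis dvd_triv_right of_nat_mult)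
  then show ?thesis using of_nat_dvd_iff by blast
qed

text \<open>Each of the m + 1 binomial coefficients of row m, multiplied by m + 1, divides the lcm
  and hence is at most the lcm. Adding up the row, the factor m + 1 cancels.\<close>

lemma Lcm_ge_power2: "2 ^ m \<le> Lcm {1..Suc m}" for m :: nat
proof -
  let ?L = "Lcm {1..Suc m}"
  have pos: "?L > 0" by (metis Lcm_0_iff_nat atLeastAtMost_iff finite_atLeastAtMost gr0I not_one_le_zero)
  have "Suc m * (m choose j) \<le> ?L" if "j \<le> m" for j
    using leibniz_triangle_Lcm[OF that, of "Suc m"] pos by (auto intro: dvd_imp_le)
  then have "(\<Sum>j\<le>m. Suc m * (m choose j)) \<le> (\<Sum>j\<le>m. ?L)" by (intro sum_mono) auto
  also have "(\<Sum>j\<le>m. Suc m * (m choose j)) = Suc m * 2 ^ m"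
    by (simp add: sum_distrib_left[symmetric] choose_row_sum del: mult_Suc)
  finally show ?thesis by (simp del: mult_Suc)
qed

text \<open>If every modulus up to m + 1 identified two elements of \<open>S\<close>, each would
  divide the product \<open>D\<close> of the positive differences in \<open>S\<close>, and so would
  their lcm, which is at least \<open>2 ^ m\<close>. But \<open>D\<close> has at most
  \<open>k * k\<close> factors, each at most n.\<close>

lemma ex_modulus_inj_on:
  fixes S :: "nat set"
  assumes "S \<subseteq> {..<n}" "card S \<le> k" "n ^ (k * k) < 2 ^ m"
  shows "\<exists>q \<in> {1..Suc m}. inj_on (\<lambda>x. x mod q) S"
proof (rule ccontr)
  assume neg: "\<not> ?thesis"
  have fin: "finite S" using assms(1) finite_subset by blast
  define P where "P = {p \<in> S \<times> S. fst p < snd p}"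
  define D where "D = (\<Prod>p\<in>P. snd p - fst p)"
  have finP: "finite P" using fin by (simp add: P_def)
  have "card P \<le> card (S \<times> S)" using fin by (intro card_mono) (auto simp: P_def)
  also have "\<dots> \<le> k * k" using assms(2) by (simp add: card_cartesian_product mult_le_mono)
  finally have cP: "card P \<le> k * k" .
  have D0: "D > 0" unfolding D_def by (rule prod_pos) (auto simp: P_def)
  have "q dvd D" if q: "q \<in> {1..Suc m}" for q
  proof -
    from neg q obtain x y where xy: "x \<in> S" "y \<in> S" "x mod q = y mod q" "x \<noteq> y"
      unfolding inj_on_def by blast
    have "\<exists>p\<in>P. q dvd snd p - fst p"
    proof (cases "x < y")
      case True
      then show ?thesis using xy mod_eq_dvd_iff_nat[of x y q]
        by (intro bexI[of _ "(x,y)"]) (auto simp: P_def)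
    next
      case False
      then show ?thesis using xy mod_eq_dvd_iff_nat[of y x q]
        by (intro bexI[of _ "(y,x)"]) (auto simp: P_def)
    qed
    then show ?thesis unfolding D_def using finP by (meson dvd_prodI dvd_trans)
  qed
  then have "Lcm {1..Suc m} dvd D" by (intro Lcm_least) auto
  then have "2 ^ m \<le> D" using Lcm_ge_power2[of m] D0 by (meson dvd_imp_le le_trans)
  moreover have "D \<le> n ^ (k * k)"
  proof -
    \<comment> \<open>The modulus 1 fails as well, so \<open>S\<close> has two elements and n is
      positive. This allows the exponent \<open>card P\<close> to be raised to
      \<open>k * k\<close>.\<close>
    have "\<exists>p. p \<in> P"
    proof -
      have "1 \<in> {1..Suc m}" by simp
      then have "\<not> inj_on (\<lambda>x. x mod 1) S" using neg by blast
      then obtain x y where xy: "x \<in> S" "y \<in> S" "x \<noteq> y" by (auto simp: inj_on_def)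
      then have "(min x y, max x y) \<in> P" by (auto simp: P_def min_def max_def)
      then show ?thesis ..
    qed
    then have "n > 0" using assms(1) by (auto simp: P_def)
    have "D \<le> (\<Prod>p\<in>P. n)" unfolding D_def using assms(1) by (intro prod_mono) (force simp: P_def)
    also have "\<dots> \<le> n ^ (k * k)" using cP \<open>n > 0\<close> by (simp add: power_increasing)
    finally show ?thesis .
  qed
  ultimately show False using assms(3) by linarith
qed

text \<open>Applied with t the binary logarithm of the size of the structure: a fixed power of a
  linear function of t is eventually below the size.\<close>

lemma eventually_poly_less_power2:
  fixes c d k :: nat
  shows "\<exists>T. \<forall>t\<ge>T. (c * t + d) ^ k < 2 ^ t"
proof -
  define C where "C = c + d + 1"
  have "((\<lambda>x::real. (x + 1) ^ k / 2 powr x) \<longlongrightarrow> 0) at_top"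
    by real_asymp
  then have "((\<lambda>t. (real t + 1) ^ k / 2 powr real t) \<longlongrightarrow> 0) sequentially"
    by (rule filterlim_compose) (rule filterlim_real_sequentially)
  then have "\<forall>\<^sub>F t in sequentially. (real t + 1) ^ k / 2 powr real t < 1 / real C ^ k"
    by (rule order_tendstoD) (simp add: C_def)
  then obtain T where T: "\<And>t. t \<ge> T \<Longrightarrow> (real t + 1) ^ k / 2 powr real t < 1 / real C ^ k"
    by (auto simp: eventually_sequentially)
  have "(c * t + d) ^ k < 2 ^ t" if "t \<ge> T" for t
  proof -
    have "c * t + d \<le> C * (t + 1)" by (simp add: C_def algebra_simps)
    then have "(c * t + d) ^ k \<le> (C * (t + 1)) ^ k" by (rule power_mono) simp
    moreover have "real C ^ k * (real t + 1) ^ k < 2 ^ t"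
      using T[OF that] by (simp add: powr_realpow C_def field_simps)
    then have "real ((C * (t + 1)) ^ k) < real (2 ^ t)"
      unfolding of_nat_power of_nat_mult power_mult_distrib by (simp add: add.commute)
    then have "(C * (t + 1)) ^ k < 2 ^ t" by (simp only: of_nat_less_iff)
    ultimately show ?thesis by linarith
  qed
  then show ?thesis by blast
qed

text \<open>A common prime divides the difference \<open>(j - i) * (fact k * q)\<close>. As
  \<open>j - i\<close> divides \<open>fact k\<close>, it divides \<open>fact k * q\<close>, hence
  also 1.\<close>

lemma coprime_beta_moduli:
  fixes q k :: nat
  assumes "i < j" "j < k"
  shows "coprime (Suc i * fact k * q + 1) (Suc j * fact k * q + 1)"
proof (rule ccontr)
  assume "\<not> ?thesis"
  then obtain p where p: "prime p" "p dvd Suc i * fact k * q + 1" "p dvd Suc j * fact k * q + 1"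
    using prime_factor_nat[of "gcd (Suc i * fact k * q + 1) (Suc j * fact k * q + 1)"]
    unfolding coprime_iff_gcd_eq_1 gcd_greatest_iff by blast
  have "p dvd (Suc j * fact k * q + 1) - (Suc i * fact k * q + 1)" using p by (intro dvd_diff_nat)
  also have "\<dots> = (j - i) * (fact k * q)" by (simp add: diff_mult_distrib distrib_right mult.assoc)
  finally have "p dvd (j - i) * (fact k * q)" .
  moreover have "j - i dvd fact k" using assms by (intro dvd_fact) auto
  ultimately have "p dvd fact k * q"
    using p(1) by (metis dvd_mult2 dvd_trans prime_dvd_multD)
  then have "p dvd Suc i * fact k * q" by (metis dvd_mult mult.assoc)
  then have "p dvd 1" using p(2) by (metis dvd_add_right_iff)
  then show False using p(1) by simp
qed

text \<open>For fixed k the modulus q and the beta moduli are O(log n), so the product of the k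
  moduli, and with it a, stays below n. The moduli are required to be below n because a formula can
  only compute with elements of the structure.\<close>

lemma ex_coloring:
  fixes k :: nat
  shows "\<exists>N. \<forall>n\<ge>N. \<forall>S v. S \<subseteq> {..<n} \<longrightarrow> card S \<le> k \<longrightarrow>
    (\<exists>q a. 0 < q \<and> q < n \<and> a < n \<and> inj_on (\<lambda>x. x mod q) S \<and>
      (\<forall>i<k. Suc i * fact k * q + 1 < n \<and> a mod (Suc i * fact k * q + 1) = v i mod q))"
proof -
  \<comment> \<open>\<open>k * fact k\<close> bounds the factors of q in the beta moduli; the
    \<open>Suc\<close> ensures that \<open>M\<close> exceeds q also if k = 0.\<close>
  let ?c = "Suc (k * fact k)"
  obtain T where T: "\<And>t. t \<ge> T \<Longrightarrow> (?c * (k * k) * t + (?c * (k * k + 2) + 2)) ^ Suc k < 2 ^ t"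
    using eventually_poly_less_power2[of "?c * (k * k)" "?c * (k * k + 2) + 2" "Suc k"] by blast
  show ?thesis
  proof (rule exI[of _ "2 ^ T"], intro allI impI)
    fix n :: nat and S and v :: "nat \<Rightarrow> nat"
    assume n: "2 ^ T \<le> n" and S: "S \<subseteq> {..<n}" "card S \<le> k"
    have "0 < n" using n by (metis gr0I le_zero_eq power_not_zero zero_neq_numeral)
    define t where "t = floor_log n"
    have t: "2 ^ t \<le> n" "n < 2 ^ Suc t"
      using \<open>0 < n\<close> floor_log_exp2_le floor_log_exp2_gt[of n] unfolding t_def by simp_all
    have "2 ^ T < (2::nat) ^ Suc t" using n t(2) by linarith
    then have "t \<ge> T" by (simp only: power_strict_increasing_iff)
    \<comment> \<open>Chosen to give \<open>n ^ (k * k) < 2 ^ m\<close> from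
      \<open>n < 2 ^ Suc t\<close>; the last summand makes the inequality strict.\<close>
    define m where "m = Suc t * (k * k) + 1"
    define M where "M = ?c * Suc m + 2"
    have "M = ?c * (k * k) * t + (?c * (k * k + 2) + 2)"
      unfolding M_def m_def by (simp add: algebra_simps)
    then have "M ^ Suc k < 2 ^ t" using T[OF \<open>t \<ge> T\<close>] by (simp only:)
    then have M: "M ^ Suc k < n" using t(1) by (rule less_le_trans)
    have "M \<ge> 1" by (simp add: M_def)
    then have Mn: "M < n" "M ^ k < n"
      using le_less_trans[OF self_le_power M] le_less_trans[OF power_increasing M] by auto
    have "n ^ (k * k) \<le> (2 ^ Suc t) ^ (k * k)" using t(2) by (intro power_mono) auto
    also have "\<dots> < 2 ^ m" unfolding m_def by (simp add: power_mult[symmetric] power_add[symmetric])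
    finally obtain q where q: "q \<in> {1..Suc m}" "inj_on (\<lambda>x. x mod q) S"
      using ex_modulus_inj_on[OF S] by blast
    let ?m = "\<lambda>i. Suc i * fact k * q + 1"
    have mM: "?m i < M" if "i < k" for i
    proof -
      have "Suc i * fact k * q \<le> k * fact k * Suc m"
        using that q(1) by (intro mult_le_mono) auto
      then show ?thesis by (simp add: M_def)
    qed
    obtain a where a: "a < (\<Prod>i<k. ?m i)" "\<And>i. i < k \<Longrightarrow> [a = v i mod q] (mod ?m i)"
    proof -
      have "\<forall>i\<in>{..<k}. \<forall>j\<in>{..<k}. i \<noteq> j \<longrightarrow> coprime (?m i) (?m j)"
        using coprime_beta_moduli by (metis coprime_commute lessThan_iff linorder_neqE_nat)
      then have "\<exists>!x. x < (\<Prod>i<k. ?m i) \<and> (\<forall>i\<in>{..<k}. [x = v i mod q] (mod ?m i))"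
        by (intro chinese_remainder_unique_nat) simp_all
      then show ?thesis using that by (metis lessThan_iff)
    qed
    have "(\<Prod>i<k. ?m i) \<le> (\<Prod>i<k. M)"
      using mM by (intro prod_mono) (metis lessThan_iff less_imp_le zero_le)
    then have "a < n" using a(1) Mn(2) by simp
    \<comment> \<open>The coded value is below its modulus, which turns the congruence into an
      equation.\<close>
    have "a mod ?m i = v i mod q" if "i < k" for i
    proof -
      have "1 * q \<le> (Suc i * fact k) * q" by (intro mult_le_mono1) (simp add: Suc_leI)
      moreover have "v i mod q < q" using q(1) by simp
      ultimately have "v i mod q < ?m i" by linarith
      then show ?thesis using a(2)[OF that] by (simp add: cong_def del: mult_Suc)
    qed
    moreover have "q < n"
    proof -
      have "Suc m \<le> ?c * Suc m" by simp
      then show ?thesis using q(1) Mn(1) by (simp add: M_def)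
    qed
    ultimately show "\<exists>q a. 0 < q \<and> q < n \<and> a < n \<and> inj_on (\<lambda>x. x mod q) S \<and>
      (\<forall>i<k. Suc i * fact k * q + 1 < n \<and> a mod (Suc i * fact k * q + 1) = v i mod q)"
      using q \<open>a < n\<close> less_trans[OF mM Mn(1)]
      by (metis atLeastAtMost_iff less_eq_Suc_le One_nat_def)
  qed
qed

subsection \<open>Duality\<close>

fun dual :: "fm \<Rightarrow> fm" where
  "dual (Atom a) = Neg (Atom a)"
| "dual (Neg \<phi>) = \<phi>"
| "dual (Conj \<phi> \<psi>) = Disj (dual \<phi>) (dual \<psi>)"
| "dual (Disj \<phi> \<psi>) = Conj (dual \<phi>) (dual \<psi>)"
| "dual (Ex x \<phi>) = All x (dual \<phi>)"
| "dual (All x \<phi>) = Ex x (dual \<phi>)"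

lemma dual_dual: "nnf \<phi> \<Longrightarrow> dual (dual \<phi>) = \<phi>"
  by (induction \<phi> rule: nnf.induct) auto

lemma nnf_dual: "nnf \<phi> \<Longrightarrow> nnf (dual \<phi>)"
  by (induction \<phi> rule: nnf.induct) auto

lemma sat_dual: "sat n rI cI e (dual \<phi>) \<longleftrightarrow> \<not> sat n rI cI e \<phi>"
  by (induction \<phi> arbitrary: e) auto

lemma fv_dual: "fv (dual \<phi>) = fv \<phi>"
  by (induction \<phi>) auto

lemma wf_dual: "wf_fm \<tau> (dual \<phi>) = wf_fm \<tau> \<phi>"
  by (induction \<phi>) auto

lemma lits_dual: "nnf \<phi> \<Longrightarrow> lits (dual \<phi>) = dual ` lits \<phi>"
  by (induction \<phi> rule: nnf.induct) auto

lemma lits_literal: "nnf \<phi> \<Longrightarrow> L \<in> lits \<phi> \<Longrightarrow> (\<exists>a. L = Atom a \<or> L = Neg (Atom a))"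
  by (induction \<phi> rule: nnf.induct) auto

text \<open>Atoms are excluded because \<open>Atom a\<close> is a subformula of
  \<open>Neg (Atom a)\<close>, whereas \<open>Neg (Atom a)\<close> is none of the dual
  \<open>Atom a\<close>.\<close>

lemma dual_in_subfms_dual:
  "nnf \<phi> \<Longrightarrow> \<theta> \<in> subfms \<phi> \<Longrightarrow> (\<And>a. \<theta> \<noteq> Atom a) \<Longrightarrow> dual \<theta> \<in> subfms (dual \<phi>)"
  by (induction \<phi> rule: nnf.induct) auto

lemma nnf_subfms: "nnf \<phi> \<Longrightarrow> \<theta> \<in> subfms \<phi> \<Longrightarrow> nnf \<theta>"
  by (induction \<phi> rule: nnf.induct) auto

lemma ex_real_lit_dual:
  assumes "nnf \<alpha>"
  shows "(\<exists>L\<in>lits (dual \<alpha>). x \<in> lit_vars L \<and> \<not> is_neq_var x L) \<longleftrightarrow>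
         (\<exists>L\<in>lits \<alpha>. x \<in> lit_vars L \<and> \<not> is_eq_var x L)"
proof -
  have "(x \<in> lit_vars (dual L) \<and> \<not> is_neq_var x (dual L)) \<longleftrightarrow> (x \<in> lit_vars L \<and> \<not> is_eq_var x L)"
    if "L \<in> lits \<alpha>" for L
    using lits_literal[OF assms that] by (auto simp: is_neq_var_def is_eq_var_def)
  then show ?thesis using assms by (auto simp: lits_dual)
qed

text \<open>Negation exchanges \<open>All\<close> with \<open>Ex\<close>, \<open>Conj\<close> with
  \<open>Disj\<close> and inequalities with equations, so each clause of one notion of weakness
  becomes the clause of the other. Weak universal quantifiers are reduced to weak existential ones
  by this.\<close>

lemma weak_ex_dual:
  assumes "nnf \<psi>"
  shows "weak_ex x (dual \<psi>) \<longleftrightarrow> weak_all x \<psi>"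
proof -
  have 1: "(\<exists>d \<chi>. All d \<chi> \<in> subfms (dual \<psi>) \<and> x \<in> fv \<chi>) \<longleftrightarrow> (\<exists>d \<chi>. Ex d \<chi> \<in> subfms \<psi> \<and> x \<in> fv \<chi>)"
    using dual_in_subfms_dual[OF assms] dual_in_subfms_dual[OF nnf_dual[OF assms]]
    unfolding dual_dual[OF assms] by (metis dual.simps(5,6) fv_dual fm.distinct)
  have 2: "(\<exists>\<alpha> \<beta>. Conj \<alpha> \<beta> \<in> subfms (dual \<psi>) \<and> P \<alpha> \<and> P \<beta>) \<longleftrightarrow>
        (\<exists>\<alpha> \<beta>. Disj \<alpha> \<beta> \<in> subfms \<psi> \<and> Q \<alpha> \<and> Q \<beta>)"
    if PQ: "\<And>\<alpha>. nnf \<alpha> \<Longrightarrow> P (dual \<alpha>) = Q \<alpha>" for P Q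
  proof
    assume "\<exists>\<alpha> \<beta>. Conj \<alpha> \<beta> \<in> subfms (dual \<psi>) \<and> P \<alpha> \<and> P \<beta>"
    then obtain \<alpha> \<beta> where ab: "Conj \<alpha> \<beta> \<in> subfms (dual \<psi>)" "P \<alpha>" "P \<beta>" by blast
    then have n: "nnf \<alpha>" "nnf \<beta>" using nnf_subfms[OF nnf_dual[OF assms] ab(1)] by auto
    have "Disj (dual \<alpha>) (dual \<beta>) \<in> subfms \<psi>"
      using dual_in_subfms_dual[OF nnf_dual[OF assms] ab(1)] by (simp add: dual_dual[OF assms])
    moreover have "Q (dual \<alpha>)" "Q (dual \<beta>)"
      using PQ[OF nnf_dual[OF n(1)]] PQ[OF nnf_dual[OF n(2)]] ab n by (simp_all add: dual_dual)
    ultimately show "\<exists>\<alpha> \<beta>. Disj \<alpha> \<beta> \<in> subfms \<psi> \<and> Q \<alpha> \<and> Q \<beta>" by blast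
  next
    assume "\<exists>\<alpha> \<beta>. Disj \<alpha> \<beta> \<in> subfms \<psi> \<and> Q \<alpha> \<and> Q \<beta>"
    then obtain \<alpha> \<beta> where ab: "Disj \<alpha> \<beta> \<in> subfms \<psi>" "Q \<alpha>" "Q \<beta>" by blast
    then have n: "nnf \<alpha>" "nnf \<beta>" using nnf_subfms[OF assms ab(1)] by auto
    have "Conj (dual \<alpha>) (dual \<beta>) \<in> subfms (dual \<psi>)"
      using dual_in_subfms_dual[OF assms ab(1)] by simp
    then show "\<exists>\<alpha> \<beta>. Conj \<alpha> \<beta> \<in> subfms (dual \<psi>) \<and> P \<alpha> \<and> P \<beta>" using PQ n ab by blast
  qed
  show ?thesis
    unfolding weak_ex_def weak_all_def 1
    using 2[of "\<lambda>\<alpha>. \<exists>L\<in>lits \<alpha>. x \<in> lit_vars L \<and> \<not> is_neq_var x L"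
        "\<lambda>\<alpha>. \<exists>L\<in>lits \<alpha>. x \<in> lit_vars L \<and> \<not> is_eq_var x L", OF ex_real_lit_dual] by blast
qed

lemma weak_all_dual: "nnf \<psi> \<Longrightarrow> weak_all x (dual \<psi>) \<longleftrightarrow> weak_ex x \<psi>"
  by (metis weak_ex_dual dual_dual nnf_dual)

lemma strong_qr_dual: "nnf \<phi> \<Longrightarrow> strong_qr (dual \<phi>) = strong_qr \<phi>"
  by (induction \<phi> rule: nnf.induct) (auto simp: weak_ex_dual weak_all_dual)

lemma strong_bound_dual: "nnf \<phi> \<Longrightarrow> strong_bound (dual \<phi>) = strong_bound \<phi>"
  by (induction \<phi> rule: nnf.induct) (auto simp: weak_ex_dual weak_all_dual)

text \<open>Bounds both the number of weak quantifiers and the number of elements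
  compared by inequality literals; hence the weight 2 of a literal.\<close>

fun weight :: "fm \<Rightarrow> nat" where
  "weight (Atom a) = 2"
| "weight (Neg \<phi>) = weight \<phi>"
| "weight (Conj \<phi> \<psi>) = weight \<phi> + weight \<psi>"
| "weight (Disj \<phi> \<psi>) = weight \<phi> + weight \<psi>"
| "weight (Ex x \<phi>) = Suc (weight \<phi>)"
| "weight (All x \<phi>) = Suc (weight \<phi>)"

lemma weight_dual: "weight (dual \<phi>) = weight \<phi>"
  by (induction \<phi>) auto

lemma weight_ge_2: "weight \<phi> \<ge> 2"
  by (induction \<phi>) auto

subsection \<open>Substitution and grounding\<close>

lemma eval_trm_cong:
  "(\<And>y. y \<in> vars_trm t \<Longrightarrow> e y = e' y) \<Longrightarrow> eval_trm n cI e t = eval_trm n cI e' t"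
  by (induction t) auto

lemma sat_atom_cong:
  assumes "\<And>y. y \<in> vars_atom a \<Longrightarrow> e y = e' y"
  shows "sat_atom n rI cI e a = sat_atom n rI cI e' a"
proof (cases a)
  case (Rel r ts)
  then have "map (eval_trm n cI e) ts = map (eval_trm n cI e') ts"
    using assms by (auto intro!: eval_trm_cong)
  then show ?thesis using Rel by (simp only: sat_atom.simps)
qed (use assms in \<open>simp_all cong: eval_trm_cong\<close>)

lemma sat_cong:
  "(\<And>y. y \<in> fv \<phi> \<Longrightarrow> e y = e' y) \<Longrightarrow> sat n rI cI e \<phi> = sat n rI cI e' \<phi>"
proof (induction \<phi> arbitrary: e e')
  case (Atom a)
  then show ?case using sat_atom_cong[of a e e'] by simp
next
  case (Neg \<phi>)
  then show ?case by (metis fv.simps(2) sat.simps(2))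
next
  case (Conj \<phi> \<psi>)
  then show ?case by (metis UnCI fv.simps(3) sat.simps(3))
next
  case (Disj \<phi> \<psi>)
  then show ?case by (metis UnCI fv.simps(4) sat.simps(4))
next
  case (Ex x \<phi>)
  have "sat n rI cI (e(x := a)) \<phi> = sat n rI cI (e'(x := a)) \<phi>" for a
    by (rule Ex.IH) (use Ex.prems in auto)
  then show ?case by simp
next
  case (All x \<phi>)
  have "sat n rI cI (e(x := a)) \<phi> = sat n rI cI (e'(x := a)) \<phi>" for a
    by (rule All.IH) (use All.prems in auto)
  then show ?case by simp
qed

fun subst_trm :: "(nat \<Rightarrow> trm) \<Rightarrow> trm \<Rightarrow> trm" where
  "subst_trm \<sigma> (V x) = \<sigma> x"
| "subst_trm \<sigma> Zero = Zero"
| "subst_trm \<sigma> (Succ t) = Succ (subst_trm \<sigma> t)"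
| "subst_trm \<sigma> (Cst c) = Cst c"

fun subst_atom :: "(nat \<Rightarrow> trm) \<Rightarrow> atom \<Rightarrow> atom" where
  "subst_atom \<sigma> (Eq s t) = Eq (subst_trm \<sigma> s) (subst_trm \<sigma> t)"
| "subst_atom \<sigma> (Lt s t) = Lt (subst_trm \<sigma> s) (subst_trm \<sigma> t)"
| "subst_atom \<sigma> (Add s t u) = Add (subst_trm \<sigma> s) (subst_trm \<sigma> t) (subst_trm \<sigma> u)"
| "subst_atom \<sigma> (Mult s t u) = Mult (subst_trm \<sigma> s) (subst_trm \<sigma> t) (subst_trm \<sigma> u)"
| "subst_atom \<sigma> (Rel r ts) = Rel r (map (subst_trm \<sigma>) ts)"

lemma eval_subst_trm:
  "eval_trm n cI e (subst_trm \<sigma> t) = eval_trm n cI (\<lambda>x. eval_trm n cI e (\<sigma> x)) t"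
  by (induction t) auto

lemma sat_subst_atom:
  "sat_atom n rI cI e (subst_atom \<sigma> a) = sat_atom n rI cI (\<lambda>x. eval_trm n cI e (\<sigma> x)) a"
  by (cases a) (auto simp: eval_subst_trm comp_def)

lemma wf_subst_trm: "(\<And>x. wf_trm \<tau> (\<sigma> x)) \<Longrightarrow> wf_trm \<tau> t \<Longrightarrow> wf_trm \<tau> (subst_trm \<sigma> t)"
  by (induction t) auto

lemma wf_subst_atom: "(\<And>x. wf_trm \<tau> (\<sigma> x)) \<Longrightarrow> wf_atom \<tau> a \<Longrightarrow> wf_atom \<tau> (subst_atom \<sigma> a)"
  by (cases a) (auto simp: wf_subst_trm)

section \<open>Numerals and quantifier-free formulas for a fixed structure size\<close>

primrec num :: "nat \<Rightarrow> trm" where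
  "num 0 = Zero"
| "num (Suc i) = Succ (num i)"

lemma eval_num: "eval_trm n cI e (num i) = min i (n - 1)"
  by (induction i) auto

lemma wf_num: "wf_trm \<tau> (num i)"
  by (induction i) auto

definition true_fm :: fm where "true_fm = Atom (Eq Zero Zero)"
definition false_fm :: fm where "false_fm = Neg true_fm"
definition disjs :: "fm list \<Rightarrow> fm" where "disjs \<phi>s = foldr Disj \<phi>s false_fm"
definition conjs :: "fm list \<Rightarrow> fm" where "conjs \<phi>s = foldr Conj \<phi>s true_fm"

lemma true_false_simps [simp]:
  "sat n rI cI e true_fm" "\<not> sat n rI cI e false_fm" "wf_fm \<tau> true_fm" "wf_fm \<tau> false_fm"
  "qr true_fm = 0" "qr false_fm = 0" "bound true_fm = {}" "bound false_fm = {}"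
  by (auto simp: true_fm_def false_fm_def)

lemma sat_disjs [simp]: "sat n rI cI e (disjs \<phi>s) \<longleftrightarrow> (\<exists>\<phi>\<in>set \<phi>s. sat n rI cI e \<phi>)"
  by (induction \<phi>s) (auto simp: disjs_def)

lemma sat_conjs [simp]: "sat n rI cI e (conjs \<phi>s) \<longleftrightarrow> (\<forall>\<phi>\<in>set \<phi>s. sat n rI cI e \<phi>)"
  by (induction \<phi>s) (auto simp: conjs_def)

lemma wf_disjs_conjs [simp]:
  "wf_fm \<tau> (disjs \<phi>s) \<longleftrightarrow> (\<forall>\<phi>\<in>set \<phi>s. wf_fm \<tau> \<phi>)"
  "wf_fm \<tau> (conjs \<phi>s) \<longleftrightarrow> (\<forall>\<phi>\<in>set \<phi>s. wf_fm \<tau> \<phi>)"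
  by (induction \<phi>s) (auto simp: disjs_def conjs_def)

lemma bound_disjs_conjs [simp]:
  "bound (disjs \<phi>s) = (\<Union>\<phi>\<in>set \<phi>s. bound \<phi>)" "bound (conjs \<phi>s) = (\<Union>\<phi>\<in>set \<phi>s. bound \<phi>)"
  by (induction \<phi>s) (auto simp: disjs_def conjs_def)

lemma qr_disjs_conjs_le [simp]:
  "qr (disjs \<phi>s) \<le> m \<longleftrightarrow> (\<forall>\<phi>\<in>set \<phi>s. qr \<phi> \<le> m)" "qr (conjs \<phi>s) \<le> m \<longleftrightarrow> (\<forall>\<phi>\<in>set \<phi>s. qr \<phi> \<le> m)"
  by (induction \<phi>s) (auto simp: disjs_def conjs_def)

fun ground :: "nat \<Rightarrow> (nat \<Rightarrow> trm) \<Rightarrow> fm \<Rightarrow> fm" where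
  "ground n \<sigma> (Atom a) = Atom (subst_atom \<sigma> a)"
| "ground n \<sigma> (Neg \<phi>) = Neg (ground n \<sigma> \<phi>)"
| "ground n \<sigma> (Conj \<phi> \<psi>) = Conj (ground n \<sigma> \<phi>) (ground n \<sigma> \<psi>)"
| "ground n \<sigma> (Disj \<phi> \<psi>) = Disj (ground n \<sigma> \<phi>) (ground n \<sigma> \<psi>)"
| "ground n \<sigma> (Ex x \<phi>) = disjs (map (\<lambda>i. ground n (\<sigma>(x := num i)) \<phi>) [0..<n])"
| "ground n \<sigma> (All x \<phi>) = conjs (map (\<lambda>i. ground n (\<sigma>(x := num i)) \<phi>) [0..<n])"

lemma sat_ground:
  "sat n rI cI e (ground n \<sigma> \<phi>) = sat n rI cI (\<lambda>x. eval_trm n cI e (\<sigma> x)) \<phi>"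
proof (induction \<phi> arbitrary: \<sigma>)
  case (Ex x \<phi>)
  have "sat n rI cI e (ground n (\<sigma>(x := num i)) \<phi>) = sat n rI cI ((\<lambda>y. eval_trm n cI e (\<sigma> y))(x := i)) \<phi>"
    if "i < n" for i
    unfolding Ex.IH by (rule sat_cong) (use that in \<open>auto simp: eval_num\<close>)
  then show ?case by auto
next
  case (All x \<phi>)
  have "sat n rI cI e (ground n (\<sigma>(x := num i)) \<phi>) = sat n rI cI ((\<lambda>y. eval_trm n cI e (\<sigma> y))(x := i)) \<phi>"
    if "i < n" for i
    unfolding All.IH by (rule sat_cong) (use that in \<open>auto simp: eval_num\<close>)
  then show ?case by auto
qed (auto simp: sat_subst_atom)

lemma wf_ground: "(\<And>x. wf_trm \<tau> (\<sigma> x)) \<Longrightarrow> wf_fm \<tau> \<phi> \<Longrightarrow> wf_fm \<tau> (ground n \<sigma> \<phi>)"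
  by (induction \<phi> arbitrary: \<sigma>) (auto simp: wf_subst_atom wf_num)

text \<open>An inequality instead of an equation, so that \<open>qr_disjs_conjs_le\<close> applies;
  \<open>le_zero_eq\<close> would rewrite it away.\<close>

lemma qr_ground: "qr (ground n \<sigma> \<phi>) \<le> 0"
  by (induction \<phi> arbitrary: \<sigma>) (auto simp: simp del: le_zero_eq)

lemma bound_ground: "bound (ground n \<sigma> \<phi>) = {}"
  by (induction \<phi> arbitrary: \<sigma>) auto

text \<open>An element of a structure of size m is denoted by a numeral, so structures of
  bounded size need no quantifiers.\<close>

lemma ex_equiv_all_sizes:
  assumes "0 < N" "wf_fm \<tau> \<phi>" "wf_fm \<tau> \<psi>"
    "\<And>n rI cI e. N \<le> n \<Longrightarrow> \<forall>v. e v < n \<Longrightarrow> sat n rI cI e \<psi> \<longleftrightarrow> sat n rI cI e \<phi>"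
  shows "\<exists>\<psi>'. wf_fm \<tau> \<psi>' \<and> qr \<psi>' = qr \<psi> \<and> bound \<psi>' = bound \<psi> \<and>
    (\<forall>n rI cI e. 0 < n \<longrightarrow> (\<forall>v. e v < n) \<longrightarrow> sat n rI cI e \<psi>' \<longleftrightarrow> sat n rI cI e \<phi>)"
  using assms
proof (induction N arbitrary: \<psi>)
  case (Suc m)
  show ?case
  proof (cases "m = 0")
    case True
    then show ?thesis using Suc.prems by (intro exI[of _ \<psi>]) auto
  next
    case False
    \<comment> \<open>\<open>Succ\<close> fixes the maximal element, so in structures of size at
      most m both numerals denote that element: \<open>?big\<close> says that the size exceeds m.
      Each induction step thus settles one more size.\<close>
    let ?big = "Atom (Lt (num (m - 1)) (num m))"
    let ?\<psi> = "Disj (Conj ?big \<psi>) (Conj (Neg ?big) (ground m V \<phi>))"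
    have "qr ?\<psi> = qr \<psi>" using qr_ground[of m V \<phi>] by simp
    moreover have "bound ?\<psi> = bound \<psi>" by (simp add: bound_ground)
    moreover have "wf_fm \<tau> ?\<psi>" using Suc.prems by (simp add: wf_num wf_ground)
    moreover have "sat n rI cI e ?\<psi> \<longleftrightarrow> sat n rI cI e \<phi>" if "m \<le> n" "\<forall>v. e v < n" for n rI cI e
    proof (cases "n = m")
      case True
      then show ?thesis using False by (simp add: eval_num sat_ground)
    next
      case nm: False
      then show ?thesis using False that Suc.prems(4)[of n e rI cI] by (auto simp: eval_num)
    qed
    ultimately show ?thesis using Suc.IH[of ?\<psi>] False Suc.prems(2) by auto
  qed
qed simp

subsection \<open>The translation of an existential block\<close>

text \<open>Here f is the first fresh variable: V f and V (f + 1) hold the parameters q and a of the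
  colouring, f + 2, ..., f + 5 are auxiliary, and f + 6, f + 7, ... replace the weak variables
  of a literal.\<close>

definition rem_fm :: "nat \<Rightarrow> trm \<Rightarrow> nat \<Rightarrow> nat \<Rightarrow> fm" where
  "rem_fm f m z r = Conj (Atom (Lt (V r) m))
     (Ex (f + 4) (Ex (f + 5) (Conj (Atom (Mult m (V (f + 4)) (V (f + 5)))) (Atom (Add (V (f + 5)) (V r) (V z))))))"

text \<open>The decoding step of the Goedel beta function: the remainder of z modulo q is the i-th
  value coded by a. Both remainder tests reuse the same two auxiliary variables.\<close>

definition color_fm :: "nat \<Rightarrow> nat \<Rightarrow> nat \<Rightarrow> nat \<Rightarrow> fm" where
  "color_fm f k i z = Ex (f + 2) (Conj (Atom (Mult (num (Suc i * fact k)) (V f) (V (f + 2))))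
     (Ex (f + 3) (Conj (rem_fm f (V f) z (f + 3)) (rem_fm f (Succ (V (f + 2))) (f + 1) (f + 3)))))"

definition remn :: "nat \<Rightarrow> nat \<Rightarrow> nat \<Rightarrow> nat \<Rightarrow> bool" where
  "remn n m z r \<longleftrightarrow> r < m \<and> (\<exists>t<n. \<exists>s<n. m * t = s \<and> s + r = z)"

text \<open>The minima and the bounds by n reproduce the saturating terms and bounded quantifiers of
  \<open>color_fm\<close> exactly. So this is the set defined by the formula for all parameters,
  including those that code nothing sensible.\<close>

definition color :: "nat \<Rightarrow> nat \<Rightarrow> nat \<Rightarrow> nat \<Rightarrow> nat \<Rightarrow> nat set" where
  "color n k q a i = {z. z < n \<and> (\<exists>h<n. min (Suc i * fact k) (n - 1) * q = h \<and>
     (\<exists>r<n. remn n q z r \<and> remn n (min (h + 1) (n - 1)) a r))}"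

lemma sat_rem_fm:
  assumes "z \<notin> {f + 4, f + 5}" "r \<notin> {f + 4, f + 5}" "vars_trm m \<inter> {f + 4, f + 5} = {}"
  shows "sat n rI cI e (rem_fm f m z r) \<longleftrightarrow> remn n (eval_trm n cI e m) (e z) (e r)"
proof -
  have "eval_trm n cI (e(f + 4 := t, f + 5 := s)) m = eval_trm n cI e m" for t s
    using assms(3) by (intro eval_trm_cong) auto
  then show ?thesis using assms(1,2) by (simp add: rem_fm_def remn_def)
qed

lemma sat_color_fm:
  assumes "z < f \<or> f + 6 \<le> z" "e z < n"
  shows "sat n rI cI e (color_fm f k i z) \<longleftrightarrow> e z \<in> color n k (e f) (e (f + 1)) i"
proof -
  have z: "z \<noteq> f + 2" "z \<noteq> f + 3" "z \<notin> {f + 4, f + 5}" using assms(1) by auto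
  have "sat n rI cI (e(f + 2 := h, f + 3 := r)) (rem_fm f (V f) z (f + 3)) \<longleftrightarrow> remn n (e f) (e z) r" for h r
    using z by (subst sat_rem_fm) auto
  moreover have "sat n rI cI (e(f + 2 := h, f + 3 := r)) (rem_fm f (Succ (V (f + 2))) (f + 1) (f + 3)) \<longleftrightarrow>
      remn n (min (h + 1) (n - 1)) (e (f + 1)) r" for h r
    by (subst sat_rem_fm) auto
  ultimately show ?thesis using assms(2)
    by (simp add: color_fm_def color_def eval_num del: mult_Suc fun_upd_apply) (simp del: mult_Suc)
qed

lemma remn_iff: "0 < m \<Longrightarrow> z < n \<Longrightarrow> remn n m z r \<longleftrightarrow> r = z mod m"
proof
  assume m: "0 < m" "z < n" "r = z mod m"
  have "z div m < n" "m * (z div m) < n"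
    using m by (auto intro: le_less_trans[OF div_le_dividend] le_less_trans[OF times_div_less_eq_dividend])
  then show "remn n m z r" using m unfolding remn_def
    by (intro conjI exI[of _ "z div m"] exI[of _ "m * (z div m)"]) auto
qed (auto simp: remn_def)

text \<open>Nothing saturates once the beta modulus is an element of the structure, and quotients
  and products in a division never exceed the dividend.\<close>

lemma color_eq:
  assumes "0 < q" "a < n" "Suc i * fact k * q + 1 < n"
  shows "color n k q a i = {z. z < n \<and> z mod q = a mod (Suc i * fact k * q + 1)}"
proof -
  let ?c = "Suc i * fact k"
  \<comment> \<open>As q is positive, the numeral for the factor \<open>?c\<close> is bounded by the
    modulus too and denotes its true value.\<close>
  have "?c * 1 \<le> ?c * q" using assms(1) by (intro mult_le_mono2) simp
  then have c: "min ?c (n - 1) = ?c" "min (?c * q + 1) (n - 1) = ?c * q + 1" using assms(3) by linarith+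
  have "?c * q < n" using assms(3) by linarith
  have 1: "remn n (min (?c * q + 1) (n - 1)) a r \<longleftrightarrow> r = a mod (?c * q + 1)" for r
    unfolding c using assms(2) by (intro remn_iff) auto
  have 2: "remn n q z r \<longleftrightarrow> r = z mod q" if "z < n" for z r
    using assms(1) that by (rule remn_iff)
  have 3: "z mod q < n" if "z < n" for z using that by (metis le_less_trans mod_less_eq_dividend)
  have "(\<exists>h<n. ?c * q = h \<and> (\<exists>r<n. remn n q z r \<and> remn n (min (h + 1) (n - 1)) a r)) \<longleftrightarrow>
      z mod q = a mod (?c * q + 1)" if "z < n" for z
    using \<open>?c * q < n\<close> 1 2[OF that] 3[OF that] by metis
  then show ?thesis unfolding color_def c(1) by blast
qed

lemma wf_color_fm: "wf_fm \<tau> (color_fm f k i z)"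
  by (simp add: color_fm_def rem_fm_def wf_num del: mult_Suc)

lemma qr_color_fm: "qr (color_fm f k i z) = 4"
  by (simp add: color_fm_def rem_fm_def)

lemma bound_color_fm: "bound (color_fm f k i z) \<subseteq> {f..<f + 6}"
  by (auto simp: color_fm_def rem_fm_def)

fun literal :: "bool \<Rightarrow> atom \<Rightarrow> fm" where
  "literal p a = (if p then Atom a else Neg (Atom a))"

text \<open>The quantifiers of the weak variables, pushed down to one literal and relativised to
  colour classes. Fresh names starting at j are substituted, so a weak variable is never bound under
  its own name.\<close>

fun bind_weak :: "nat \<Rightarrow> nat \<Rightarrow> (nat \<Rightarrow> nat option) \<Rightarrow> bool \<Rightarrow> nat \<Rightarrow> (nat \<Rightarrow> trm) \<Rightarrow> nat list \<Rightarrow> atom \<Rightarrow> fm" where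
  "bind_weak f k \<kappa> p j \<sigma> [] a = literal p (subst_atom \<sigma> a)"
| "bind_weak f k \<kappa> p j \<sigma> (x # xs) a =
     Ex j (Conj (color_fm f k (the (\<kappa> x)) j) (bind_weak f k \<kappa> p (Suc j) (\<sigma>(x := V j)) xs a))"

definition real_lit :: "nat \<Rightarrow> nat \<Rightarrow> (nat \<Rightarrow> nat option) \<Rightarrow> bool \<Rightarrow> atom \<Rightarrow> fm" where
  "real_lit f k \<kappa> p a = bind_weak f k \<kappa> p (f + 6) V (sorted_list_of_set (vars_atom a \<inter> dom \<kappa>)) a"

text \<open>An inequality is replaced by a statement that makes it true for all choices from the
  colour classes: the other element lies outside the class, or the two classes are disjoint. Hence
  it does not restrict the choice of a weak value.\<close>

definition neg_lit :: "nat \<Rightarrow> nat \<Rightarrow> (nat \<Rightarrow> nat option) \<Rightarrow> atom \<Rightarrow> fm" where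
  "neg_lit f k \<kappa> a = (case a of Eq (V x) (V y) \<Rightarrow>
       (case (\<kappa> x, \<kappa> y) of
         (None, None) \<Rightarrow> Neg (Atom a)
       | (Some i, None) \<Rightarrow> Neg (color_fm f k i y)
       | (None, Some j) \<Rightarrow> Neg (color_fm f k j x)
       | (Some i, Some j) \<Rightarrow> Neg (Ex (f + 6) (Conj (color_fm f k i (f + 6)) (color_fm f k j (f + 6)))))
     | _ \<Rightarrow> real_lit f k \<kappa> False a)"

lemma neg_lit_real:
  assumes "\<And>x y. a \<noteq> Eq (V x) (V y)"
  shows "neg_lit f k \<kappa> a = real_lit f k \<kappa> False a"
  using assms by (auto simp: neg_lit_def split: atom.splits trm.splits)

text \<open>Translates a block of existential quantifiers. The partial map \<kappa> assigns colours to the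
  weak variables in scope and b is the next unused colour. Universal subformulas are translated by
  g as long as no strong quantifier of the block has been passed, and by h afterwards.\<close>

fun block :: "nat \<Rightarrow> nat \<Rightarrow> (fm \<Rightarrow> fm) \<Rightarrow> (fm \<Rightarrow> fm) \<Rightarrow> (nat \<Rightarrow> nat option) \<Rightarrow> nat \<Rightarrow> fm \<Rightarrow> fm" where
  "block f k g h \<kappa> b (Atom a) = real_lit f k \<kappa> True a"
| "block f k g h \<kappa> b (Neg (Atom a)) = neg_lit f k \<kappa> a"
| "block f k g h \<kappa> b (Neg \<phi>) = Neg \<phi>"
| "block f k g h \<kappa> b (Conj \<phi> \<psi>) = Conj (block f k g h \<kappa> b \<phi>) (block f k g h \<kappa> (b + weight \<phi>) \<psi>)"
| "block f k g h \<kappa> b (Disj \<phi> \<psi>) = Disj (block f k g h \<kappa> b \<phi>) (block f k g h \<kappa> (b + weight \<phi>) \<psi>)"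
| "block f k g h \<kappa> b (Ex x \<phi>) = (if weak_ex x \<phi>
     then Conj (Ex (f + 6) (color_fm f k b (f + 6))) (block f k g h (\<kappa>(x \<mapsto> b)) (Suc b) \<phi>)
     else Ex x (block f k h h (\<kappa>(x := None)) b \<phi>))"
| "block f k g h \<kappa> b (All x \<phi>) = g (All x \<phi>)"

text \<open>The occurrences that \<open>block\<close> passes to its first function. Only weak
  existential quantifiers lie above them inside the formula, and by weakness none of these binds a
  variable free in them.\<close>

fun pulled :: "fm \<Rightarrow> fm list" where
  "pulled (Conj \<phi> \<psi>) = pulled \<phi> @ pulled \<psi>"
| "pulled (Disj \<phi> \<psi>) = pulled \<phi> @ pulled \<psi>"
| "pulled (Ex x \<phi>) = (if weak_ex x \<phi> then pulled \<phi> else [])"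
| "pulled (All x \<phi>) = [All x \<phi>]"
| "pulled _ = []"

section \<open>Well-formedness, bound variables and quantifier rank of translated blocks\<close>

lemma card_vars_trm: "finite (vars_trm t) \<and> card (vars_trm t) \<le> 1"
  by (induction t) auto

lemma finite_vars_atom: "finite (vars_atom a)"
  using card_vars_trm by (cases a) auto

lemma finite_fv: "finite (fv \<phi>)"
  by (induction \<phi>) (auto simp: finite_vars_atom)

lemma arity_ge_3: "finite (srels \<tau>) \<Longrightarrow> 3 \<le> arity \<tau>"
  unfolding arity_def by (rule Max_ge) auto

lemma card_vars_atom:
  assumes "finite (srels \<tau>)" "wf_atom \<tau> a"
  shows "card (vars_atom a) \<le> arity \<tau>"
proof -
  have 2: "card (vars_trm s \<union> vars_trm t) \<le> 2" for s t
    using card_vars_trm[of s] card_vars_trm[of t] card_Un_le[of "vars_trm s" "vars_trm t"] by linarith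
  then have 3: "card (vars_trm s \<union> vars_trm t \<union> vars_trm u) \<le> 3" for s t u
    using card_vars_trm[of u] card_Un_le[of "vars_trm s \<union> vars_trm t" "vars_trm u"] 
    by (metis add_mono add.commute le_trans numeral_2_eq_2 numeral_3_eq_3 plus_1_eq_Suc)
  have rel: "card (\<Union>t\<in>set ts. vars_trm t) \<le> length ts" for ts
  proof -
    have "card (\<Union>t\<in>set ts. vars_trm t) \<le> (\<Sum>t\<in>set ts. card (vars_trm t))"
      by (rule card_UN_le) simp
    also have "\<dots> \<le> (\<Sum>t\<in>set ts. 1)" using card_vars_trm by (intro sum_mono) blast
    also have "\<dots> \<le> length ts" by (simp add: card_length)
    finally show ?thesis .
  qed
  show ?thesis
  proof (cases a)
    case (Rel r ts)
    have "sar \<tau> r \<le> arity \<tau>" unfolding arity_def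
      using assms Rel by (intro Max_ge) auto
    then show ?thesis using rel[of ts] assms(2) Rel by simp
  next
    case (Eq s t)
    then show ?thesis using 2[of s t] arity_ge_3[OF assms(1)] by simp
  next
    case (Lt s t)
    then show ?thesis using 2[of s t] arity_ge_3[OF assms(1)] by simp
  next
    case (Add s t u)
    then show ?thesis using 3[of s t u] arity_ge_3[OF assms(1)] by simp
  next
    case (Mult s t u)
    then show ?thesis using 3[of s t u] arity_ge_3[OF assms(1)] by simp
  qed
qed

text \<open>Every weak variable of the literal costs one quantifier and one name from
  \<open>f + 6\<close> on, and there are at most \<open>arity \<tau>\<close> of them. The colour
  tests have rank 4 and reuse names below \<open>f + 6\<close>.\<close>

lemma real_lit_syntax:
  assumes "finite (srels \<tau>)" "wf_atom \<tau> a"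
  shows "wf_fm \<tau> (real_lit f k \<kappa> p a)" "qr (real_lit f k \<kappa> p a) \<le> arity \<tau> + 5"
    "bound (real_lit f k \<kappa> p a) \<subseteq> {f..<f + 6 + arity \<tau>}"
proof -
  have wf: "wf_fm \<tau> (bind_weak f k \<kappa> p j \<sigma> xs a)" if "\<And>x. wf_trm \<tau> (\<sigma> x)" for j \<sigma> xs
    using that assms(2) by (induction xs arbitrary: j \<sigma>) (auto simp: wf_subst_atom wf_color_fm)
  have qr: "qr (bind_weak f k \<kappa> p j \<sigma> xs a) \<le> length xs + 4" for j \<sigma> xs
    by (induction xs arbitrary: j \<sigma>) (simp_all add: qr_color_fm add.commute)
  have bound: "bound (bind_weak f k \<kappa> p j \<sigma> xs a) \<subseteq> {f..<f + 6} \<union> {j..<j + length xs}" for j \<sigma> xs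
  proof (induction xs arbitrary: j \<sigma>)
    case (Cons x xs)
    have "bound (bind_weak f k \<kappa> p (Suc j) (\<sigma>(x := V j)) xs a) \<subseteq> {f..<f + 6} \<union> {Suc j..<Suc j + length xs}"
      by (rule Cons)
    moreover have "{Suc j..<Suc j + length xs} \<subseteq> {j..<j + length (x # xs)}" "j \<in> {j..<j + length (x # xs)}"
      by auto
    ultimately show ?case using bound_color_fm[of f k "the (\<kappa> x)" j] unfolding bind_weak.simps bound.simps
      by blast
  qed auto
  have "card (vars_atom a \<inter> dom \<kappa>) \<le> card (vars_atom a)"
    by (intro card_mono finite_vars_atom) auto
  then have len: "length (sorted_list_of_set (vars_atom a \<inter> dom \<kappa>)) \<le> arity \<tau>"
    using card_vars_atom[OF assms] by (simp add: finite_vars_atom)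
  show "wf_fm \<tau> (real_lit f k \<kappa> p a)" using wf by (simp add: real_lit_def)
  show "qr (real_lit f k \<kappa> p a) \<le> arity \<tau> + 5"
    using qr[of "f + 6" V "sorted_list_of_set (vars_atom a \<inter> dom \<kappa>)"] len unfolding real_lit_def by linarith
  show "bound (real_lit f k \<kappa> p a) \<subseteq> {f..<f + 6 + arity \<tau>}"
    using bound[of "f + 6" V "sorted_list_of_set (vars_atom a \<inter> dom \<kappa>)"] len unfolding real_lit_def by force
qed

lemma neg_lit_syntax:
  assumes "finite (srels \<tau>)" "wf_atom \<tau> a"
  shows "wf_fm \<tau> (neg_lit f k \<kappa> a)" "qr (neg_lit f k \<kappa> a) \<le> arity \<tau> + 5"
    "bound (neg_lit f k \<kappa> a) \<subseteq> {f..<f + 6 + arity \<tau>}"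
proof -
  have "wf_fm \<tau> (neg_lit f k \<kappa> a) \<and> qr (neg_lit f k \<kappa> a) \<le> arity \<tau> + 5 \<and>
    bound (neg_lit f k \<kappa> a) \<subseteq> {f..<f + 6 + arity \<tau>}"
  proof (cases "\<exists>x y. a = Eq (V x) (V y)")
    case False
    then show ?thesis using neg_lit_real real_lit_syntax[OF assms] by metis
  next
    case True
    have "f \<le> x \<and> x < f + 6 + arity \<tau>" if "x \<in> bound (color_fm f k i z)" for x i z
      using bound_color_fm[of f k i z] that by force
    then show ?thesis
      using True assms arity_ge_3[OF assms(1)]
      by (auto simp: neg_lit_def wf_color_fm qr_color_fm split: option.splits)
  qed
  then show "wf_fm \<tau> (neg_lit f k \<kappa> a)" "qr (neg_lit f k \<kappa> a) \<le> arity \<tau> + 5"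
    "bound (neg_lit f k \<kappa> a) \<subseteq> {f..<f + 6 + arity \<tau>}" by auto
qed

lemma subfms_refl: "\<phi> \<in> subfms \<phi>"
  by (cases \<phi>) auto

lemma wf_block:
  assumes "finite (srels \<tau>)" "nnf \<psi>" "wf_fm \<tau> \<psi>"
    "\<And>l. l \<in> subfms \<psi> \<Longrightarrow> wf_fm \<tau> (g l) \<and> wf_fm \<tau> (h l)"
  shows "wf_fm \<tau> (block f k g h \<kappa> b \<psi>)"
  using assms(2-)
proof (induction \<psi> arbitrary: g \<kappa> b rule: nnf.induct)
  case (6 x \<phi>)
  have "wf_fm \<tau> (block f k g h \<kappa> b \<phi>)" for \<kappa> b
    by (rule "6.IH") (use "6.prems" in auto)
  moreover have "wf_fm \<tau> (block f k h h \<kappa> b \<phi>)" for \<kappa> b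
    by (rule "6.IH") (use "6.prems" in auto)
  ultimately show ?case by (simp add: wf_color_fm)
qed (simp_all add: real_lit_syntax(1)[OF assms(1)] neg_lit_syntax(1)[OF assms(1)] subfms_refl)

text \<open>Only strong variables keep their names. The translated universal subformulas draw on the
  same window of fresh names, so nesting adds nothing.\<close>

lemma bound_block:
  assumes "finite (srels \<tau>)" "nnf \<psi>" "wf_fm \<tau> \<psi>"
    "\<And>l. l \<in> subfms \<psi> \<Longrightarrow>
      bound (g l) \<subseteq> strong_bound l \<union> {f..<f + 6 + arity \<tau>} \<and>
      bound (h l) \<subseteq> strong_bound l \<union> {f..<f + 6 + arity \<tau>}"
  shows "bound (block f k g h \<kappa> b \<psi>) \<subseteq> strong_bound \<psi> \<union> {f..<f + 6 + arity \<tau>}"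
  using assms(2-)
proof (induction \<psi> arbitrary: g \<kappa> b rule: nnf.induct)
  case (1 a)
  then show ?case using real_lit_syntax(3)[OF assms(1), of a f k \<kappa> True] by simp
next
  case (2 a)
  then show ?case using neg_lit_syntax(3)[OF assms(1), of a f k \<kappa>] by simp
next
  case (4 \<phi> \<psi>)
  have "bound (block f k g h \<kappa> b \<phi>) \<subseteq> strong_bound \<phi> \<union> {f..<f + 6 + arity \<tau>}" for b
    by (rule "4.IH"(1)) (use "4.prems" in auto)
  moreover have "bound (block f k g h \<kappa> b \<psi>) \<subseteq> strong_bound \<psi> \<union> {f..<f + 6 + arity \<tau>}" for b
    by (rule "4.IH"(2)) (use "4.prems" in auto)
  ultimately show ?case by fastforce
next
  case (5 \<phi> \<psi>)
  have "bound (block f k g h \<kappa> b \<phi>) \<subseteq> strong_bound \<phi> \<union> {f..<f + 6 + arity \<tau>}" for b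
    by (rule "5.IH"(1)) (use "5.prems" in auto)
  moreover have "bound (block f k g h \<kappa> b \<psi>) \<subseteq> strong_bound \<psi> \<union> {f..<f + 6 + arity \<tau>}" for b
    by (rule "5.IH"(2)) (use "5.prems" in auto)
  ultimately show ?case by fastforce
next
  case (6 x \<phi>)
  have "bound (block f k g h \<kappa> b \<phi>) \<subseteq> strong_bound \<phi> \<union> {f..<f + 6 + arity \<tau>}" for \<kappa> b
    by (rule "6.IH") (use "6.prems" in auto)
  moreover have "bound (block f k h h \<kappa> b \<phi>) \<subseteq> strong_bound \<phi> \<union> {f..<f + 6 + arity \<tau>}" for \<kappa> b
    by (rule "6.IH") (use "6.prems" in auto)
  moreover have "bound (color_fm f k b (f + 6)) \<subseteq> {f..<f + 6 + arity \<tau>}" "f + 6 \<in> {f..<f + 6 + arity \<tau>}"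
    using bound_color_fm[of f k b "f + 6"] arity_ge_3[OF assms(1)] by force+
  ultimately show ?case unfolding block.simps strong_bound.simps
    by (cases "weak_ex x \<phi>") (simp_all only: if_True if_False bound.simps, blast+)
next
  case (7 x \<phi>)
  then show ?case using "7.prems"(3)[of "All x \<phi>"] subfms_refl by auto
qed auto

text \<open>The slack d counts the quantifiers for q and a that will be put in front of the block.
  It is reserved only until a strong quantifier is passed, which is why g has to respect d and h
  does not.\<close>

lemma qr_block:
  assumes "finite (srels \<tau>)" "nnf \<psi>" "wf_fm \<tau> \<psi>"
    "\<And>l. l \<in> subfms \<psi> \<Longrightarrow>
      qr (g l) + d \<le> 3 * strong_qr l + arity \<tau> + 7 \<and> qr (h l) \<le> 3 * strong_qr l + arity \<tau> + 7"
    "d \<le> 2"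
  shows "qr (block f k g h \<kappa> b \<psi>) + d \<le> 3 * strong_qr \<psi> + arity \<tau> + 7"
  using assms(2-)
proof (induction \<psi> arbitrary: g d \<kappa> b rule: nnf.induct)
  case (1 a)
  then show ?case using real_lit_syntax(2)[OF assms(1), of a f k \<kappa> True] by auto
next
  case (2 a)
  then show ?case using neg_lit_syntax(2)[OF assms(1), of a f k \<kappa>] by auto
next
  case (4 \<phi> \<psi>)
  have "qr (block f k g h \<kappa> b \<phi>) + d \<le> 3 * strong_qr \<phi> + arity \<tau> + 7" for b
    by (rule "4.IH"(1)) (use "4.prems" in auto)
  moreover have "qr (block f k g h \<kappa> b \<psi>) + d \<le> 3 * strong_qr \<psi> + arity \<tau> + 7" for b
    by (rule "4.IH"(2)) (use "4.prems" in auto)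
  ultimately have "qr (block f k g h \<kappa> b \<phi>) + d \<le> 3 * strong_qr \<phi> + arity \<tau> + 7"
    "qr (block f k g h \<kappa> (b + weight \<phi>) \<psi>) + d \<le> 3 * strong_qr \<psi> + arity \<tau> + 7" by blast+
  then show ?case by (auto simp: max_def)
next
  case (5 \<phi> \<psi>)
  have "qr (block f k g h \<kappa> b \<phi>) + d \<le> 3 * strong_qr \<phi> + arity \<tau> + 7" for b
    by (rule "5.IH"(1)) (use "5.prems" in auto)
  moreover have "qr (block f k g h \<kappa> b \<psi>) + d \<le> 3 * strong_qr \<psi> + arity \<tau> + 7" for b
    by (rule "5.IH"(2)) (use "5.prems" in auto)
  ultimately have "qr (block f k g h \<kappa> b \<phi>) + d \<le> 3 * strong_qr \<phi> + arity \<tau> + 7"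
    "qr (block f k g h \<kappa> (b + weight \<phi>) \<psi>) + d \<le> 3 * strong_qr \<psi> + arity \<tau> + 7" by blast+
  then show ?case by (auto simp: max_def)
next
  case (6 x \<phi>)
  have "qr (block f k g h \<kappa> b \<phi>) + d \<le> 3 * strong_qr \<phi> + arity \<tau> + 7" for \<kappa> b
    by (rule "6.IH") (use "6.prems" in auto)
  \<comment> \<open>Below a strong quantifier the slack is reset to 0: the 3 granted for that
    quantifier pay for itself and for the at most 2 reserved above.\<close>
  moreover have "qr (block f k h h \<kappa> b \<phi>) + 0 \<le> 3 * strong_qr \<phi> + arity \<tau> + 7" for \<kappa> b
    by (rule "6.IH") (use "6.prems" in auto)
  ultimately have "qr (block f k g h (\<kappa>(x \<mapsto> b)) (Suc b) \<phi>) + d \<le> 3 * strong_qr \<phi> + arity \<tau> + 7"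
    "qr (block f k h h (\<kappa>(x := None)) b \<phi>) + 0 \<le> 3 * strong_qr \<phi> + arity \<tau> + 7" by blast+
  then show ?case using "6.prems"(4) arity_ge_3[OF assms(1)] by (auto simp: qr_color_fm max_def)
next
  case (7 x \<phi>)
  then show ?case using "7.prems"(3)[of "All x \<phi>"] subfms_refl by auto
qed auto

subsection \<open>Soundness\<close>

definition override :: "(nat \<Rightarrow> nat option) \<Rightarrow> (nat \<Rightarrow> nat) \<Rightarrow> (nat \<Rightarrow> nat) \<Rightarrow> nat \<Rightarrow> nat" where
  "override \<kappa> v e = (\<lambda>x. if \<kappa> x = None then e x else v x)"

definition colored :: "(nat \<Rightarrow> nat set) \<Rightarrow> (nat \<Rightarrow> nat option) \<Rightarrow> (nat \<Rightarrow> nat) \<Rightarrow> bool" where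
  "colored C \<kappa> v \<longleftrightarrow> (\<forall>x i. \<kappa> x = Some i \<longrightarrow> v x \<in> C i)"

text \<open>The occurrences counted by condition (ii) of weakness: a weak variable is in this set
  for at most one side of a conjunction.\<close>

definition real_vars :: "fm \<Rightarrow> nat set" where
  "real_vars \<psi> = {x. \<exists>L\<in>lits \<psi>. x \<in> lit_vars L \<and> \<not> is_neq_var x L}"

lemma color_less: "z \<in> color n k q a i \<Longrightarrow> z < n"
  by (simp add: color_def)

lemma fv_literal: "fv (literal p a) = vars_atom a"
  by simp

text \<open>The nested quantifiers amount to one simultaneous choice from the colour classes. The
  condition on \<open>\<sigma>\<close> keeps the names j, j + 1, ... out of the terms already
  substituted, so nothing is captured.\<close>

lemma sat_bind_weak:
  assumes "distinct xs" "f + 6 \<le> j" "\<And>y. y \<in> vars_atom a - set xs \<Longrightarrow> vars_trm (\<sigma> y) \<subseteq> {..<j}"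
  shows "sat n rI cI e (bind_weak f k \<kappa> p j \<sigma> xs a) \<longleftrightarrow>
    (\<exists>v. (\<forall>x\<in>set xs. v x \<in> color n k (e f) (e (f + 1)) (the (\<kappa> x))) \<and>
      sat n rI cI (\<lambda>x. if x \<in> set xs then v x else eval_trm n cI e (\<sigma> x)) (literal p a))"
  using assms
proof (induction xs arbitrary: j \<sigma> e)
  case Nil
  then show ?case by (simp add: sat_subst_atom)
next
  case (Cons x xs)
  let ?C = "\<lambda>x. color n k (e f) (e (f + 1)) (the (\<kappa> x))"
  let ?env = "\<lambda>v y. if y \<in> set (x # xs) then v y else eval_trm n cI e (\<sigma> y)"
  have env: "sat n rI cI (\<lambda>y. if y \<in> set xs then v y else eval_trm n cI (e(j := c)) ((\<sigma>(x := V j)) y)) (literal p a)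
     = sat n rI cI (?env (v(x := c))) (literal p a)" for v c
  proof (rule sat_cong)
    fix y assume "y \<in> fv (literal p a)"
    then have y: "y \<in> vars_atom a" by (simp only: fv_literal)
    show "(if y \<in> set xs then v y else eval_trm n cI (e(j := c)) ((\<sigma>(x := V j)) y)) = ?env (v(x := c)) y"
    proof (cases "y \<in> set (x # xs)")
      case True
      then show ?thesis using Cons.prems(1) by auto
    next
      case False
      then have "vars_trm (\<sigma> y) \<subseteq> {..<j}" using Cons.prems(3) y by blast
      then have "eval_trm n cI (e(j := c)) (\<sigma> y) = eval_trm n cI e (\<sigma> y)"
        by (intro eval_trm_cong) auto
      then show ?thesis using False by simp
    qed
  qed
  have IH: "sat n rI cI (e(j := c)) (bind_weak f k \<kappa> p (Suc j) (\<sigma>(x := V j)) xs a) \<longleftrightarrow>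
     (\<exists>v. (\<forall>x\<in>set xs. v x \<in> ?C x) \<and> sat n rI cI (?env (v(x := c))) (literal p a))" for c
  proof -
    have "vars_trm ((\<sigma>(x := V j)) y) \<subseteq> {..<Suc j}" if "y \<in> vars_atom a - set xs" for y
      using Cons.prems(3)[of y] that by (auto intro: less_SucI)
    then have "sat n rI cI (e(j := c)) (bind_weak f k \<kappa> p (Suc j) (\<sigma>(x := V j)) xs a) \<longleftrightarrow>
      (\<exists>v. (\<forall>x\<in>set xs. v x \<in> color n k ((e(j := c)) f) ((e(j := c)) (f + 1)) (the (\<kappa> x))) \<and>
        sat n rI cI (\<lambda>y. if y \<in> set xs then v y else eval_trm n cI (e(j := c)) ((\<sigma>(x := V j)) y)) (literal p a))"
      using Cons.prems by (intro Cons.IH) auto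
    then show ?thesis unfolding env using Cons.prems(2) by simp
  qed
  have col: "sat n rI cI (e(j := c)) (color_fm f k (the (\<kappa> x)) j) \<longleftrightarrow> c \<in> ?C x" if "c < n" for c
    using sat_color_fm[of j f "e(j := c)"] that Cons.prems(2) by simp
  have "sat n rI cI e (bind_weak f k \<kappa> p j \<sigma> (x # xs) a) \<longleftrightarrow>
     (\<exists>c<n. c \<in> ?C x \<and> (\<exists>v. (\<forall>x\<in>set xs. v x \<in> ?C x) \<and> sat n rI cI (?env (v(x := c))) (literal p a)))"
    unfolding bind_weak.simps sat.simps IH using col by blast
  also have "\<dots> \<longleftrightarrow> (\<exists>v. (\<forall>x\<in>set (x # xs). v x \<in> ?C x) \<and> sat n rI cI (?env v) (literal p a))"
    (is "?l = ?r")
  proof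
    assume ?l
    then obtain c v where cv: "c \<in> ?C x" "\<forall>x\<in>set xs. v x \<in> ?C x" "sat n rI cI (?env (v(x := c))) (literal p a)"
      by blast
    have "\<forall>y\<in>set (x # xs). (v(x := c)) y \<in> ?C y" using cv(1,2) by auto
    then show ?r using cv(3) by blast
  next
    assume ?r
    then obtain v where v: "\<forall>x\<in>set (x # xs). v x \<in> ?C x" "sat n rI cI (?env (v(x := v x))) (literal p a)"
      unfolding fun_upd_triv by blast
    then have "v x \<in> ?C x" "\<forall>y\<in>set xs. v y \<in> ?C y" by simp_all
    then show ?l using color_less[of "v x"] v(2) by blast
  qed
  finally show ?case .
qed

lemma sat_real_lit:
  assumes "vars_atom a \<subseteq> {..<f}"
  shows "sat n rI cI e (real_lit f k \<kappa> p a) \<longleftrightarrow>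
    (\<exists>v. (\<forall>x\<in>vars_atom a. \<forall>i. \<kappa> x = Some i \<longrightarrow> v x \<in> color n k (e f) (e (f + 1)) i) \<and>
      sat n rI cI (override \<kappa> v e) (literal p a))"
proof -
  let ?xs = "sorted_list_of_set (vars_atom a \<inter> dom \<kappa>)"
  have set: "set ?xs = vars_atom a \<inter> dom \<kappa>" by (simp add: finite_vars_atom)
  have "sat n rI cI e (real_lit f k \<kappa> p a) \<longleftrightarrow>
    (\<exists>v. (\<forall>x\<in>set ?xs. v x \<in> color n k (e f) (e (f + 1)) (the (\<kappa> x))) \<and>
      sat n rI cI (\<lambda>x. if x \<in> set ?xs then v x else eval_trm n cI e (V x)) (literal p a))"
    unfolding real_lit_def using assms by (intro sat_bind_weak) auto
  moreover have "sat n rI cI (\<lambda>x. if x \<in> set ?xs then v x else eval_trm n cI e (V x)) (literal p a) =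
      sat n rI cI (override \<kappa> v e) (literal p a)" for v
    by (rule sat_cong) (unfold set fv_literal, auto simp: override_def)
  moreover have "(\<forall>x\<in>set ?xs. v x \<in> color n k (e f) (e (f + 1)) (the (\<kappa> x))) \<longleftrightarrow>
      (\<forall>x\<in>vars_atom a. \<forall>i. \<kappa> x = Some i \<longrightarrow> v x \<in> color n k (e f) (e (f + 1)) i)" for v
    unfolding set by force
  ultimately show ?thesis by simp
qed

lemma weak_ex_mono: "weak_ex x \<psi> \<Longrightarrow> subfms \<theta> \<subseteq> subfms \<psi> \<Longrightarrow> weak_ex x \<theta>"
  unfolding weak_ex_def by blast

lemma weak_ex_Conj: "weak_ex x (Conj \<alpha> \<beta>) \<Longrightarrow> x \<notin> real_vars \<alpha> \<inter> real_vars \<beta>"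
  unfolding weak_ex_def real_vars_def using subfms_refl[of "Conj \<alpha> \<beta>"] by blast

lemma weak_ex_All: "weak_ex x (All d \<chi>) \<Longrightarrow> x \<notin> fv (All d \<chi>)"
  unfolding weak_ex_def by auto

lemma pulled_subfms: "l \<in> set (pulled \<psi>) \<Longrightarrow> l \<in> subfms \<psi> \<and> (\<exists>d \<chi>. l = All d \<chi>)"
  by (induction \<psi> rule: pulled.induct) (auto split: if_splits)

text \<open>A literal determines values only for its own weak variables; the others get arbitrary
  elements of their colours, which requires the colours to be nonempty.\<close>

lemma colored_extend:
  assumes "\<And>x i. \<kappa> x = Some i \<Longrightarrow> C i \<noteq> {}" "\<And>x i. x \<in> A \<Longrightarrow> \<kappa> x = Some i \<Longrightarrow> v x \<in> C i"
  shows "\<exists>w. colored C \<kappa> w \<and> (\<forall>x\<in>A. \<kappa> x \<noteq> None \<longrightarrow> w x = v x)"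
proof (intro exI conjI)
  let ?w = "\<lambda>x. if x \<in> A then v x else SOME u. u \<in> C (the (\<kappa> x))"
  show "colored C \<kappa> ?w" unfolding colored_def
    using assms by (auto simp: some_in_eq)
qed simp

text \<open>A weak variable takes its value from the single conjunct containing a real literal with it.
  In the other conjuncts any element of its colour works; this is why the conclusion
  only fixes the values of the variables in real literals.\<close>

lemma block_sound:
  assumes "nnf \<psi>" "fv \<psi> \<union> bound \<psi> \<subseteq> {..<f}" "\<And>v. e v < n"
    "\<And>x. x \<in> dom \<kappa> \<Longrightarrow> weak_ex x \<psi>"
    "\<And>x i. \<kappa> x = Some i \<Longrightarrow> color n k (e f) (e (f + 1)) i \<noteq> {}"
    "\<And>l. l \<in> set (pulled \<psi>) \<Longrightarrow> sat n rI cI e (g l) \<Longrightarrow> sat n rI cI e l"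
    "\<And>l e. l \<in> subfms \<psi> \<Longrightarrow> (\<And>v. e v < n) \<Longrightarrow> sat n rI cI e (h l) \<Longrightarrow> sat n rI cI e l"
    "sat n rI cI e (block f k g h \<kappa> b \<psi>)"
  shows "\<exists>v. colored (color n k (e f) (e (f + 1))) \<kappa> v \<and>
    (\<forall>w. colored (color n k (e f) (e (f + 1))) \<kappa> w \<longrightarrow> (\<forall>x\<in>real_vars \<psi> \<inter> dom \<kappa>. w x = v x) \<longrightarrow>
      sat n rI cI (override \<kappa> w e) \<psi>)"
  using assms
proof (induction \<psi> arbitrary: g e \<kappa> b rule: nnf.induct)
  case (1 a)
  let ?C = "color n k (e f) (e (f + 1))"
  obtain v where v: "\<And>x i. x \<in> vars_atom a \<Longrightarrow> \<kappa> x = Some i \<Longrightarrow> v x \<in> ?C i" "sat n rI cI (override \<kappa> v e) (Atom a)"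
    using "1.prems"(2,8) by (auto simp: sat_real_lit)
  obtain v' where v': "colored ?C \<kappa> v'" "\<And>x. x \<in> vars_atom a \<Longrightarrow> \<kappa> x \<noteq> None \<Longrightarrow> v' x = v x"
    using colored_extend[of \<kappa> ?C "vars_atom a" v] v(1) "1.prems"(5) by blast
  have real: "real_vars (Atom a) = vars_atom a" by (auto simp: real_vars_def is_neq_var_def)
  show ?case
  proof (intro exI[of _ v'] conjI allI impI)
    fix w assume w: "\<forall>x\<in>real_vars (Atom a) \<inter> dom \<kappa>. w x = v' x"
    have "w x = v x" if "x \<in> vars_atom a" "\<kappa> x \<noteq> None" for x
      using w v'(2)[OF that] that unfolding real by (metis IntI domIff)
    then have "sat n rI cI (override \<kappa> w e) (Atom a) = sat n rI cI (override \<kappa> v e) (Atom a)"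
      by (intro sat_cong) (auto simp: override_def)
    then show "sat n rI cI (override \<kappa> w e) (Atom a)" using v(2) by blast
  qed (rule v')
next
  case (2 a)
  let ?C = "color n k (e f) (e (f + 1))"
  show ?case
  proof (cases "\<exists>x y. a = Eq (V x) (V y)")
    case True
    then obtain x y where a: "a = Eq (V x) (V y)" by blast
    have xy: "x < f" "y < f" using "2.prems"(2) a by auto
    obtain v where v: "colored ?C \<kappa> v" using colored_extend[of \<kappa> ?C "{}"] "2.prems"(5) by auto
    \<comment> \<open>True for every choice from the colour classes, so any \<open>v\<close> can be
      used.\<close>
    have "override \<kappa> w e x \<noteq> override \<kappa> w e y" if "colored ?C \<kappa> w" for w
    proof -
      have w: "\<kappa> z = Some i \<Longrightarrow> w z \<in> ?C i" for z i using that by (auto simp: colored_def)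
      have col: "sat n rI cI e (color_fm f k i z) \<longleftrightarrow> e z \<in> ?C i" if "z < f" for z i
        using that "2.prems"(3) by (intro sat_color_fm) auto
      have col': "sat n rI cI (e(f + 6 := c)) (color_fm f k i (f + 6)) \<longleftrightarrow> c \<in> ?C i" if "c < n" for c i
        using sat_color_fm[of "f + 6" f "e(f + 6 := c)"] that by simp
      show ?thesis
      proof (cases "\<kappa> x"; cases "\<kappa> y")
        assume "\<kappa> x = None" "\<kappa> y = None"
        then show ?thesis using "2.prems"(8) by (simp add: a neg_lit_def override_def)
      next
        fix i assume k: "\<kappa> x = None" "\<kappa> y = Some i"
        then have "e x \<notin> ?C i" using "2.prems"(8) col xy by (simp add: a neg_lit_def)
        then show ?thesis using w[OF k(2)] k by (auto simp: override_def)
      next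
        fix i assume k: "\<kappa> x = Some i" "\<kappa> y = None"
        then have "e y \<notin> ?C i" using "2.prems"(8) col xy by (simp add: a neg_lit_def)
        then show ?thesis using w[OF k(1)] k by (auto simp: override_def)
      next
        fix i j assume k: "\<kappa> x = Some i" "\<kappa> y = Some j"
        then have "\<not> (\<exists>c<n. sat n rI cI (e(f + 6 := c)) (color_fm f k i (f + 6)) \<and>
            sat n rI cI (e(f + 6 := c)) (color_fm f k j (f + 6)))"
          using "2.prems"(8) by (simp add: a neg_lit_def)
        then have "\<not> (c \<in> ?C i \<and> c \<in> ?C j)" for c
          using col' color_less by blast
        then show ?thesis using w[OF k(1)] w[OF k(2)] k by (auto simp: override_def)
      qed
    qed
    then show ?thesis using v a by auto
  next
    case False
    have "sat n rI cI e (real_lit f k \<kappa> False a)"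
      using "2.prems"(8) False by (simp add: neg_lit_real)
    then obtain v where v: "\<forall>x\<in>vars_atom a. \<forall>i. \<kappa> x = Some i \<longrightarrow> v x \<in> ?C i"
      "sat n rI cI (override \<kappa> v e) (Neg (Atom a))"
      using "2.prems"(2) sat_real_lit[of a f n rI cI e k \<kappa> False] by auto
    obtain v' where v': "colored ?C \<kappa> v'" "\<And>x. x \<in> vars_atom a \<Longrightarrow> \<kappa> x \<noteq> None \<Longrightarrow> v' x = v x"
      using colored_extend[of \<kappa> ?C "vars_atom a" v] v(1) "2.prems"(5) by blast
    have real: "real_vars (Neg (Atom a)) = vars_atom a" using False by (auto simp: real_vars_def is_neq_var_def)
    show ?thesis
    proof (intro exI[of _ v'] conjI allI impI)
      fix w assume w: "\<forall>x\<in>real_vars (Neg (Atom a)) \<inter> dom \<kappa>. w x = v' x"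
      have "w x = v x" if "x \<in> vars_atom a" "\<kappa> x \<noteq> None" for x
        using w v'(2)[OF that] that unfolding real by (metis IntI domIff)
      then have "sat n rI cI (override \<kappa> w e) (Neg (Atom a)) = sat n rI cI (override \<kappa> v e) (Neg (Atom a))"
        by (intro sat_cong) (auto simp: override_def)
      then show "sat n rI cI (override \<kappa> w e) (Neg (Atom a))" using v(2) by blast
    qed (rule v')
  qed
next
  case (4 \<alpha> \<beta>)
  let ?C = "color n k (e f) (e (f + 1))"
  have weak: "weak_ex x \<alpha>" "weak_ex x \<beta>" "x \<notin> real_vars \<alpha> \<inter> real_vars \<beta>" if "x \<in> dom \<kappa>" for x
    using weak_ex_mono[OF "4.prems"(4)[OF that]] weak_ex_Conj[OF "4.prems"(4)[OF that]] by auto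
  have "\<exists>v. colored ?C \<kappa> v \<and> (\<forall>w. colored ?C \<kappa> w \<longrightarrow> (\<forall>x\<in>real_vars \<alpha> \<inter> dom \<kappa>. w x = v x) \<longrightarrow>
      sat n rI cI (override \<kappa> w e) \<alpha>)"
    by (rule "4.IH"(1)[where g = g and b = b]) (use "4.prems" weak in auto)
  then obtain va where va: "colored ?C \<kappa> va"
    "\<And>w. colored ?C \<kappa> w \<Longrightarrow> (\<forall>x\<in>real_vars \<alpha> \<inter> dom \<kappa>. w x = va x) \<Longrightarrow> sat n rI cI (override \<kappa> w e) \<alpha>" by blast
  have "\<exists>v. colored ?C \<kappa> v \<and> (\<forall>w. colored ?C \<kappa> w \<longrightarrow> (\<forall>x\<in>real_vars \<beta> \<inter> dom \<kappa>. w x = v x) \<longrightarrow>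
      sat n rI cI (override \<kappa> w e) \<beta>)"
    by (rule "4.IH"(2)[where g = g and b = "b + weight \<alpha>"]) (use "4.prems" weak in auto)
  then obtain vb where vb: "colored ?C \<kappa> vb"
    "\<And>w. colored ?C \<kappa> w \<Longrightarrow> (\<forall>x\<in>real_vars \<beta> \<inter> dom \<kappa>. w x = vb x) \<Longrightarrow> sat n rI cI (override \<kappa> w e) \<beta>" by blast
  \<comment> \<open>No weak variable is real on both sides, so the two choices cannot conflict where
    they matter.\<close>
  let ?v = "\<lambda>x. if x \<in> real_vars \<alpha> then va x else vb x"
  have real: "real_vars (Conj \<alpha> \<beta>) = real_vars \<alpha> \<union> real_vars \<beta>" by (auto simp: real_vars_def)
  show ?case
  proof (intro exI[of _ ?v] conjI allI impI)
    show "colored ?C \<kappa> ?v" using va(1) vb(1) by (auto simp: colored_def)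
    fix w assume w: "colored ?C \<kappa> w" "\<forall>x\<in>real_vars (Conj \<alpha> \<beta>) \<inter> dom \<kappa>. w x = ?v x"
    have "\<forall>x\<in>real_vars \<alpha> \<inter> dom \<kappa>. w x = va x" using w(2) unfolding real by simp
    moreover have "\<forall>x\<in>real_vars \<beta> \<inter> dom \<kappa>. w x = vb x" using w(2) weak(3) unfolding real by auto
    ultimately show "sat n rI cI (override \<kappa> w e) (Conj \<alpha> \<beta>)" using va(2) vb(2) w(1) by simp
  qed
next
  case (5 \<alpha> \<beta>)
  let ?C = "color n k (e f) (e (f + 1))"
  have weak: "weak_ex x \<alpha>" "weak_ex x \<beta>" if "x \<in> dom \<kappa>" for x
    using weak_ex_mono[OF "5.prems"(4)[OF that]] by auto
  have real: "real_vars (Disj \<alpha> \<beta>) = real_vars \<alpha> \<union> real_vars \<beta>" by (auto simp: real_vars_def)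
  from "5.prems"(8) consider "sat n rI cI e (block f k g h \<kappa> b \<alpha>)" | "sat n rI cI e (block f k g h \<kappa> (b + weight \<alpha>) \<beta>)"
    by auto
  then show ?case
  proof cases
    case 1
    have "\<exists>v. colored ?C \<kappa> v \<and> (\<forall>w. colored ?C \<kappa> w \<longrightarrow> (\<forall>x\<in>real_vars \<alpha> \<inter> dom \<kappa>. w x = v x) \<longrightarrow>
        sat n rI cI (override \<kappa> w e) \<alpha>)"
      by (rule "5.IH"(1)[where g = g and b = b]) (use "5.prems" weak 1 in auto)
    then show ?thesis unfolding real sat.simps by blast
  next
    case 2
    have "\<exists>v. colored ?C \<kappa> v \<and> (\<forall>w. colored ?C \<kappa> w \<longrightarrow> (\<forall>x\<in>real_vars \<beta> \<inter> dom \<kappa>. w x = v x) \<longrightarrow>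
        sat n rI cI (override \<kappa> w e) \<beta>)"
      by (rule "5.IH"(2)[where g = g and b = "b + weight \<alpha>"]) (use "5.prems" weak 2 in auto)
    then show ?thesis unfolding real sat.simps by blast
  qed
next
  case (6 x \<phi>)
  let ?C = "color n k (e f) (e (f + 1))"
  have real: "real_vars (Ex x \<phi>) = real_vars \<phi>" by (auto simp: real_vars_def)
  have weak: "weak_ex y \<phi>" if "y \<in> dom \<kappa>" for y
    using weak_ex_mono[OF "6.prems"(4)[OF that]] by auto
  have xf: "x < f" using "6.prems"(2) by simp
  have vars: "fv \<phi> \<union> bound \<phi> \<subseteq> {..<f}" using "6.prems"(2) by auto
  show ?case
  proof (cases "weak_ex x \<phi>")
    case True
    have sat: "sat n rI cI e (Ex (f + 6) (color_fm f k b (f + 6)))" "sat n rI cI e (block f k g h (\<kappa>(x \<mapsto> b)) (Suc b) \<phi>)"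
      using "6.prems"(8) True by simp_all
    \<comment> \<open>From the explicit nonemptiness conjunct: x may occur in no real literal, and
      then nothing else provides a value of its colour.\<close>
    have "?C b \<noteq> {}"
      using sat(1) sat_color_fm[of "f + 6" f "e(f + 6 := c)" n for c] by auto
    have "\<exists>v. colored ?C (\<kappa>(x \<mapsto> b)) v \<and> (\<forall>w. colored ?C (\<kappa>(x \<mapsto> b)) w \<longrightarrow>
        (\<forall>y\<in>real_vars \<phi> \<inter> dom (\<kappa>(x \<mapsto> b)). w y = v y) \<longrightarrow> sat n rI cI (override (\<kappa>(x \<mapsto> b)) w e) \<phi>)"
    proof (rule "6.IH"[where g = g and b = "Suc b"])
      show "weak_ex y \<phi>" if "y \<in> dom (\<kappa>(x \<mapsto> b))" for y
        using weak True that by (cases "y = x") auto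
      show "?C i \<noteq> {}" if "(\<kappa>(x \<mapsto> b)) y = Some i" for y i
        using \<open>?C b \<noteq> {}\<close> "6.prems"(5)[of y i] that by (auto split: if_splits)
      show "sat n rI cI e (block f k g h (\<kappa>(x \<mapsto> b)) (Suc b) \<phi>)" by (rule sat(2))
    qed (use "6.prems" True vars in auto)
    then obtain v where v: "colored ?C (\<kappa>(x \<mapsto> b)) v"
      "\<And>w. colored ?C (\<kappa>(x \<mapsto> b)) w \<Longrightarrow> (\<forall>y\<in>real_vars \<phi> \<inter> dom (\<kappa>(x \<mapsto> b)). w y = v y) \<Longrightarrow>
         sat n rI cI (override (\<kappa>(x \<mapsto> b)) w e) \<phi>" by blast
    have vx: "v x \<in> ?C b" using v(1) by (simp add: colored_def)
    obtain v' where v': "colored ?C \<kappa> v'" "\<And>y. y \<noteq> x \<Longrightarrow> \<kappa> y \<noteq> None \<Longrightarrow> v' y = v y"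
      using colored_extend[of \<kappa> ?C "- {x}" v] "6.prems"(5) v(1) by (auto simp: colored_def)
    show ?thesis
    proof (intro exI[of _ v'] conjI allI impI)
      fix w assume w: "colored ?C \<kappa> w" "\<forall>y\<in>real_vars (Ex x \<phi>) \<inter> dom \<kappa>. w y = v' y"
      have wv: "w y = v y" if "y \<in> real_vars \<phi>" "\<kappa> y \<noteq> None" "y \<noteq> x" for y
        using w(2) v'(2)[OF that(3,2)] that(1,2) unfolding real by (metis IntI domIff)
      \<comment> \<open>The witness for x is the value that the choice for the body assigns to
        it.\<close>
      have "colored ?C (\<kappa>(x \<mapsto> b)) (w(x := v x))" using w(1) vx by (auto simp: colored_def)
      moreover have "\<forall>y\<in>real_vars \<phi> \<inter> dom (\<kappa>(x \<mapsto> b)). (w(x := v x)) y = v y"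
        using wv by auto
      ultimately have "sat n rI cI (override (\<kappa>(x \<mapsto> b)) (w(x := v x)) e) \<phi>" by (rule v(2))
      moreover have "override (\<kappa>(x \<mapsto> b)) (w(x := v x)) e = (override \<kappa> w e)(x := v x)"
        by (auto simp: override_def)
      ultimately show "sat n rI cI (override \<kappa> w e) (Ex x \<phi>)" using color_less[OF vx] by auto
    qed (rule v'(1))
  next
    case False
    then obtain c where c: "c < n" "sat n rI cI (e(x := c)) (block f k h h (\<kappa>(x := None)) b \<phi>)"
      using "6.prems"(8) by auto
    have C: "color n k ((e(x := c)) f) ((e(x := c)) (f + 1)) = ?C" using xf by simp
    have hg: "sat n rI cI (e(x := c)) l" if "l \<in> set (pulled \<phi>)" "sat n rI cI (e(x := c)) (h l)" for l
    proof (rule "6.prems"(7))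
      show "l \<in> subfms (Ex x \<phi>)" using pulled_subfms[OF that(1)] by simp
      show "(e(x := c)) v < n" for v using "6.prems"(3) c(1) by simp
    qed (rule that(2))
    have "\<exists>v. colored ?C (\<kappa>(x := None)) v \<and> (\<forall>w. colored ?C (\<kappa>(x := None)) w \<longrightarrow>
        (\<forall>y\<in>real_vars \<phi> \<inter> dom (\<kappa>(x := None)). w y = v y) \<longrightarrow> sat n rI cI (override (\<kappa>(x := None)) w (e(x := c))) \<phi>)"
      unfolding C[symmetric]
    proof (rule "6.IH"[where g = h and b = b])
      show "color n k ((e(x := c)) f) ((e(x := c)) (f + 1)) i \<noteq> {}" if "(\<kappa>(x := None)) y = Some i" for y i
        using "6.prems"(5)[of y i] that unfolding C by (auto split: if_splits)
      show "sat n rI cI (e(x := c)) (block f k h h (\<kappa>(x := None)) b \<phi>)" by (rule c(2))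
      show "weak_ex y \<phi>" if "y \<in> dom (\<kappa>(x := None))" for y
        using weak[of y] that by auto
      show "sat n rI cI (e(x := c)) l" if "l \<in> set (pulled \<phi>)" "sat n rI cI (e(x := c)) (h l)" for l
        using that by (rule hg)
      show "(e(x := c)) u < n" for u using "6.prems"(3) c(1) by simp
    qed (use "6.prems"(1,7) vars in auto)
    then obtain v where v: "colored ?C (\<kappa>(x := None)) v"
      "\<And>w. colored ?C (\<kappa>(x := None)) w \<Longrightarrow> (\<forall>y\<in>real_vars \<phi> \<inter> dom (\<kappa>(x := None)). w y = v y) \<Longrightarrow>
         sat n rI cI (override (\<kappa>(x := None)) w (e(x := c))) \<phi>" by blast
    obtain v' where v': "colored ?C \<kappa> v'" "\<And>y. y \<noteq> x \<Longrightarrow> \<kappa> y \<noteq> None \<Longrightarrow> v' y = v y"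
      using colored_extend[of \<kappa> ?C "- {x}" v] "6.prems"(5) v(1) by (auto simp: colored_def)
    show ?thesis
    proof (intro exI[of _ v'] conjI allI impI)
      fix w assume w: "colored ?C \<kappa> w" "\<forall>y\<in>real_vars (Ex x \<phi>) \<inter> dom \<kappa>. w y = v' y"
      have wv: "w y = v y" if "y \<in> real_vars \<phi>" "\<kappa> y \<noteq> None" "y \<noteq> x" for y
        using w(2) v'(2)[OF that(3,2)] that(1,2) unfolding real by (metis IntI domIff)
      have "colored ?C (\<kappa>(x := None)) w" using w(1) by (auto simp: colored_def)
      moreover have "\<forall>y\<in>real_vars \<phi> \<inter> dom (\<kappa>(x := None)). w y = v y"
        using wv by auto
      ultimately have "sat n rI cI (override (\<kappa>(x := None)) w (e(x := c))) \<phi>" by (rule v(2))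
      moreover have "override (\<kappa>(x := None)) w (e(x := c)) = (override \<kappa> w e)(x := c)"
        by (auto simp: override_def)
      ultimately show "sat n rI cI (override \<kappa> w e) (Ex x \<phi>)" using c(1) by auto
    qed (rule v'(1))
  qed
next
  case (7 x \<phi>)
  let ?C = "color n k (e f) (e (f + 1))"
  obtain v where v: "colored ?C \<kappa> v" using colored_extend[of \<kappa> ?C "{}"] "7.prems"(5) by auto
  have "sat n rI cI e (All x \<phi>)" using "7.prems"(6,8) by simp
  \<comment> \<open>By weakness no weak variable in scope is free in a universal subformula.\<close>
  moreover have "sat n rI cI (override \<kappa> w e) (All x \<phi>) = sat n rI cI e (All x \<phi>)" for w
    by (rule sat_cong) (use weak_ex_All[OF "7.prems"(4)] in \<open>auto simp: override_def\<close>)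
  ultimately show ?case using v by blast
qed auto

subsection \<open>Completeness\<close>

definition residue_class :: "nat \<Rightarrow> nat \<Rightarrow> nat \<Rightarrow> nat set" where
  "residue_class n q z = {u. u < n \<and> u mod q = z mod q}"

text \<open>\<open>E\<close> evaluates the original formula, with witnesses for the weak variables;
  \<open>e\<close> evaluates the translation and holds q and a at f and f + 1. \<open>S\<close>
  collects the elements to be separated modulo q, and \<open>v\<close> the values that the colours
  in \<open>I\<close>, not yet in use, are meant to represent.\<close>

definition admissible ::
  "nat \<Rightarrow> nat \<Rightarrow> nat \<Rightarrow> nat set \<Rightarrow> (nat \<Rightarrow> nat) \<Rightarrow> nat set \<Rightarrow> (nat \<Rightarrow> nat option) \<Rightarrow> (nat \<Rightarrow> nat) \<Rightarrow> (nat \<Rightarrow> nat) \<Rightarrow> bool" where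
  "admissible n f k I v S \<kappa> E e \<longleftrightarrow> (\<forall>u. e u < n) \<and> (\<forall>y. y < f \<longrightarrow> y \<notin> dom \<kappa> \<longrightarrow> e y = E y) \<and>
     inj_on (\<lambda>x. x mod e f) S \<and>
     (\<forall>i\<in>I. color n k (e f) (e (f + 1)) i = residue_class n (e f) (v i)) \<and>
     (\<forall>x i. \<kappa> x = Some i \<longrightarrow> color n k (e f) (e (f + 1)) i = residue_class n (e f) (E x))"

lemma admissible_mono:
  "admissible n f k I v S \<kappa> E e \<Longrightarrow> I' \<subseteq> I \<Longrightarrow> S' \<subseteq> S \<Longrightarrow> (\<And>i. i \<in> I' \<Longrightarrow> v' i = v i) \<Longrightarrow>
    admissible n f k I' v' S' \<kappa> E e"
  unfolding admissible_def by (metis inj_on_subset subsetD)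

text \<open>The values in \<open>E\<close> serve as the choice, since each of them lies in its own
  residue class.\<close>

lemma sat_real_lit_admissible:
  assumes "admissible n f k I v S \<kappa> E e" "vars_atom a \<subseteq> {..<f}" "\<And>v. E v < n"
    "sat n rI cI E (literal p a)"
  shows "sat n rI cI e (real_lit f k \<kappa> p a)"
proof -
  have "sat n rI cI (override \<kappa> E e) (literal p a) = sat n rI cI E (literal p a)"
  proof (rule sat_cong)
    fix y assume "y \<in> fv (literal p a)"
    then have "y < f" unfolding fv_literal using assms(2) by auto
    then show "override \<kappa> E e y = E y"
      using assms(1) unfolding admissible_def override_def by (auto simp: domIff)
  qed
  moreover have "\<forall>x\<in>vars_atom a. \<forall>i. \<kappa> x = Some i \<longrightarrow> E x \<in> color n k (e f) (e (f + 1)) i"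
    using assms(1,3) unfolding admissible_def residue_class_def by blast
  ultimately show ?thesis using assms(4) unfolding sat_real_lit[OF assms(2)] by blast
qed

text \<open>\<open>S\<close> and \<open>v\<close> are chosen before \<open>e\<close>, because q and
  a can only be found once all elements to separate and all colours to represent are known. They are
  read off from one satisfying choice of witnesses, strong ones included, and their number is
  bounded by the weight.\<close>

lemma block_complete:
  assumes "nnf \<psi>" "fv \<psi> \<union> bound \<psi> \<subseteq> {..<f}" "\<And>v. E v < n"
    "\<And>x. x \<in> dom \<kappa> \<Longrightarrow> weak_ex x \<psi>"
    "\<And>l e. l \<in> set (pulled \<psi>) \<Longrightarrow> sat n rI cI E l \<Longrightarrow> (\<And>v. e v < n) \<Longrightarrow> (\<And>y. y \<in> fv l \<Longrightarrow> e y = E y) \<Longrightarrow>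
      sat n rI cI e (g l)"
    "\<And>l e. l \<in> subfms \<psi> \<Longrightarrow> (\<And>v. e v < n) \<Longrightarrow> sat n rI cI e l \<Longrightarrow> sat n rI cI e (h l)"
    "sat n rI cI E \<psi>"
  shows "\<exists>S v. S \<subseteq> {..<n} \<and> card S \<le> weight \<psi> \<and>
    (\<forall>e. admissible n f k {b..<b + weight \<psi>} v S \<kappa> E e \<longrightarrow> sat n rI cI e (block f k g h \<kappa> b \<psi>))"
  using assms
proof (induction \<psi> arbitrary: g E \<kappa> b rule: nnf.induct)
  case (1 a)
  have "sat n rI cI e (block f k g h \<kappa> b (Atom a))" if "admissible n f k I v S \<kappa> E e" for e I v S
    using sat_real_lit_admissible[OF that, of a rI cI True] "1.prems" by simp
  then show ?case by (intro exI[of _ "{}"]) simp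
next
  case (2 a)
  show ?case
  proof (cases "\<exists>x y. a = Eq (V x) (V y)")
    case False
    have "sat n rI cI e (block f k g h \<kappa> b (Neg (Atom a)))" if "admissible n f k I v S \<kappa> E e" for e I v S
      using sat_real_lit_admissible[OF that, of a rI cI False] "2.prems" False by (simp add: neg_lit_real)
    then show ?thesis by (intro exI[of _ "{}"]) simp
  next
    case True
    then obtain x y where a: "a = Eq (V x) (V y)" by blast
    have xy: "x < f" "y < f" "E x \<noteq> E y" using "2.prems"(2,7) a by auto
    have sat: "sat n rI cI e (neg_lit f k \<kappa> a)" if adm: "admissible n f k I v {E x, E y} \<kappa> E e" for e I v
    proof -
      let ?C = "color n k (e f) (e (f + 1))"
      have en: "e u < n" for u using adm by (simp add: admissible_def)
      have agree: "e u = E u" if "u < f" "\<kappa> u = None" for u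
        using adm that by (simp add: admissible_def domIff)
      have mod: "E x mod e f \<noteq> E y mod e f" using adm xy(3) by (auto simp: admissible_def)
      have C: "\<kappa> u = Some i \<Longrightarrow> ?C i = residue_class n (e f) (E u)" for u i
        using adm by (simp add: admissible_def)
      have col: "sat n rI cI e (color_fm f k i z) \<longleftrightarrow> e z \<in> ?C i" if "z < f" for z i
        using that en by (intro sat_color_fm) auto
      have col': "sat n rI cI (e(f + 6 := c)) (color_fm f k i (f + 6)) \<longleftrightarrow> c \<in> ?C i" if "c < n" for c i
        using sat_color_fm[of "f + 6" f "e(f + 6 := c)"] that by simp
      show ?thesis
      proof (cases "\<kappa> x"; cases "\<kappa> y")
        assume "\<kappa> x = None" "\<kappa> y = None"
        then show ?thesis using agree xy by (simp add: a neg_lit_def)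
      next
        fix i assume k: "\<kappa> x = None" "\<kappa> y = Some i"
        have "e x \<notin> ?C i" unfolding C[OF k(2)] agree[OF xy(1) k(1)] using mod by (simp add: residue_class_def)
        then show ?thesis using col[OF xy(1)] k by (simp add: a neg_lit_def)
      next
        fix i assume k: "\<kappa> x = Some i" "\<kappa> y = None"
        have "e y \<notin> ?C i" unfolding C[OF k(1)] agree[OF xy(2) k(2)] using mod by (simp add: residue_class_def)
        then show ?thesis using col[OF xy(2)] k by (simp add: a neg_lit_def)
      next
        fix i j assume k: "\<kappa> x = Some i" "\<kappa> y = Some j"
        have "\<not> (c \<in> ?C i \<and> c \<in> ?C j)" for c
          unfolding C[OF k(1)] C[OF k(2)] using mod by (simp add: residue_class_def)
        then have "\<not> (\<exists>c<n. sat n rI cI (e(f + 6 := c)) (color_fm f k i (f + 6)) \<and>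
            sat n rI cI (e(f + 6 := c)) (color_fm f k j (f + 6)))"
          using col' by blast
        then show ?thesis using k by (simp add: a neg_lit_def)
      qed
    qed
    have "card {E x, E y} \<le> 2" by (simp add: card_insert_if)
    then show ?thesis using "2.prems"(3) sat by (intro exI[of _ "{E x, E y}"]) simp
  qed
next
  case (4 \<alpha> \<beta>)
  have weak: "weak_ex x \<alpha>" "weak_ex x \<beta>" if "x \<in> dom \<kappa>" for x
    using weak_ex_mono[OF "4.prems"(4)[OF that]] by auto
  have "\<exists>S v. S \<subseteq> {..<n} \<and> card S \<le> weight \<alpha> \<and>
    (\<forall>e. admissible n f k {b..<b + weight \<alpha>} v S \<kappa> E e \<longrightarrow> sat n rI cI e (block f k g h \<kappa> b \<alpha>))"
    by (rule "4.IH"(1)) (use "4.prems" weak in auto)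
  then obtain Sa va where a: "Sa \<subseteq> {..<n}" "card Sa \<le> weight \<alpha>"
    "\<And>e. admissible n f k {b..<b + weight \<alpha>} va Sa \<kappa> E e \<Longrightarrow> sat n rI cI e (block f k g h \<kappa> b \<alpha>)" by blast
  let ?b = "b + weight \<alpha>"
  have "\<exists>S v. S \<subseteq> {..<n} \<and> card S \<le> weight \<beta> \<and>
    (\<forall>e. admissible n f k {?b..<?b + weight \<beta>} v S \<kappa> E e \<longrightarrow> sat n rI cI e (block f k g h \<kappa> ?b \<beta>))"
    by (rule "4.IH"(2)) (use "4.prems" weak in auto)
  then obtain Sb vb where b: "Sb \<subseteq> {..<n}" "card Sb \<le> weight \<beta>"
    "\<And>e. admissible n f k {?b..<?b + weight \<beta>} vb Sb \<kappa> E e \<Longrightarrow> sat n rI cI e (block f k g h \<kappa> ?b \<beta>)" by blast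
  \<comment> \<open>The two sides use disjoint ranges of colours, so their requirements can be
    merged.\<close>
  let ?v = "\<lambda>i. if i < ?b then va i else vb i"
  have "sat n rI cI e (block f k g h \<kappa> b (Conj \<alpha> \<beta>))"
    if adm: "admissible n f k {b..<b + weight (Conj \<alpha> \<beta>)} ?v (Sa \<union> Sb) \<kappa> E e" for e
  proof -
    have "admissible n f k {b..<b + weight \<alpha>} va Sa \<kappa> E e" by (rule admissible_mono[OF adm]) auto
    moreover have "admissible n f k {?b..<?b + weight \<beta>} vb Sb \<kappa> E e" by (rule admissible_mono[OF adm]) auto
    ultimately show ?thesis using a(3) b(3) by simp
  qed
  moreover have "card (Sa \<union> Sb) \<le> weight (Conj \<alpha> \<beta>)"
    using a(2) b(2) card_Un_le[of Sa Sb] by simp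
  ultimately show ?case using a(1) b(1) by (intro exI[of _ "Sa \<union> Sb"] exI[of _ ?v]) blast
next
  case (5 \<alpha> \<beta>)
  have weak: "weak_ex x \<alpha>" "weak_ex x \<beta>" if "x \<in> dom \<kappa>" for x
    using weak_ex_mono[OF "5.prems"(4)[OF that]] by auto
  let ?b = "b + weight \<alpha>"
  from "5.prems"(7) consider "sat n rI cI E \<alpha>" | "sat n rI cI E \<beta>" by auto
  then show ?case
  proof cases
    case 1
    have "\<exists>S v. S \<subseteq> {..<n} \<and> card S \<le> weight \<alpha> \<and>
      (\<forall>e. admissible n f k {b..<b + weight \<alpha>} v S \<kappa> E e \<longrightarrow> sat n rI cI e (block f k g h \<kappa> b \<alpha>))"
      by (rule "5.IH"(1)) (use "5.prems" weak 1 in auto)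
    then obtain S v where a: "S \<subseteq> {..<n}" "card S \<le> weight \<alpha>"
      "\<And>e. admissible n f k {b..<b + weight \<alpha>} v S \<kappa> E e \<Longrightarrow> sat n rI cI e (block f k g h \<kappa> b \<alpha>)" by blast
    have "sat n rI cI e (block f k g h \<kappa> b (Disj \<alpha> \<beta>))"
      if adm: "admissible n f k {b..<b + weight (Disj \<alpha> \<beta>)} v S \<kappa> E e" for e
    proof -
      have "admissible n f k {b..<b + weight \<alpha>} v S \<kappa> E e" by (rule admissible_mono[OF adm]) auto
      then show ?thesis using a(3) by simp
    qed
    then show ?thesis using a(1,2) by (intro exI[of _ S] exI[of _ v]) auto
  next
    case 2
    have "\<exists>S v. S \<subseteq> {..<n} \<and> card S \<le> weight \<beta> \<and>
      (\<forall>e. admissible n f k {?b..<?b + weight \<beta>} v S \<kappa> E e \<longrightarrow> sat n rI cI e (block f k g h \<kappa> ?b \<beta>))"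
      by (rule "5.IH"(2)) (use "5.prems" weak 2 in auto)
    then obtain S v where a: "S \<subseteq> {..<n}" "card S \<le> weight \<beta>"
      "\<And>e. admissible n f k {?b..<?b + weight \<beta>} v S \<kappa> E e \<Longrightarrow> sat n rI cI e (block f k g h \<kappa> ?b \<beta>)" by blast
    have "sat n rI cI e (block f k g h \<kappa> b (Disj \<alpha> \<beta>))"
      if adm: "admissible n f k {b..<b + weight (Disj \<alpha> \<beta>)} v S \<kappa> E e" for e
    proof -
      have "admissible n f k {?b..<?b + weight \<beta>} v S \<kappa> E e" by (rule admissible_mono[OF adm]) auto
      then show ?thesis using a(3) by simp
    qed
    then show ?thesis using a(1,2) by (intro exI[of _ S] exI[of _ v]) auto
  qed
next
  case (6 x \<phi>)
  obtain c where c: "c < n" "sat n rI cI (E(x := c)) \<phi>" using "6.prems"(7) by auto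
  let ?E = "E(x := c)"
  have En: "?E u < n" for u using c(1) "6.prems"(3) by simp
  have weak: "weak_ex y \<phi>" if "y \<in> dom \<kappa>" for y
    using weak_ex_mono[OF "6.prems"(4)[OF that]] by auto
  have xf: "x < f" using "6.prems"(2) by simp
  have vars: "fv \<phi> \<union> bound \<phi> \<subseteq> {..<f}" using "6.prems"(2) by auto
  show ?case
  proof (cases "weak_ex x \<phi>")
    case True
    have hg: "sat n rI cI e (g l)" if l: "l \<in> set (pulled \<phi>)" and E: "sat n rI cI ?E l"
      and e: "\<And>v. e v < n" "\<And>y. y \<in> fv l \<Longrightarrow> e y = ?E y" for l e
    proof -
      have "x \<notin> fv l"
        using True pulled_subfms[OF l] unfolding weak_ex_def by auto
      then have "sat n rI cI E l = sat n rI cI ?E l" by (intro sat_cong) auto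
      moreover have "e y = E y" if "y \<in> fv l" for y using e(2)[OF that] \<open>x \<notin> fv l\<close> that by auto
      ultimately show ?thesis using "6.prems"(5)[of l e] l E e(1) True by simp
    qed
    have "\<exists>S v. S \<subseteq> {..<n} \<and> card S \<le> weight \<phi> \<and>
      (\<forall>e. admissible n f k {Suc b..<Suc b + weight \<phi>} v S (\<kappa>(x \<mapsto> b)) ?E e \<longrightarrow>
        sat n rI cI e (block f k g h (\<kappa>(x \<mapsto> b)) (Suc b) \<phi>))"
    proof (rule "6.IH")
      show "weak_ex y \<phi>" if "y \<in> dom (\<kappa>(x \<mapsto> b))" for y
        using weak True that by (cases "y = x") auto
      show "sat n rI cI e (g l)" if "l \<in> set (pulled \<phi>)" "sat n rI cI ?E l"
        "\<And>v. e v < n" "\<And>y. y \<in> fv l \<Longrightarrow> e y = ?E y" for l e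
        using that by (rule hg)
      show "?E u < n" for u by (rule En)
      show "sat n rI cI ?E \<phi>" by (rule c(2))
    qed (use "6.prems"(1,6) vars in auto)
    then obtain S v where S: "S \<subseteq> {..<n}" "card S \<le> weight \<phi>"
      "\<And>e. admissible n f k {Suc b..<Suc b + weight \<phi>} v S (\<kappa>(x \<mapsto> b)) ?E e \<Longrightarrow>
        sat n rI cI e (block f k g h (\<kappa>(x \<mapsto> b)) (Suc b) \<phi>)" by blast
    \<comment> \<open>The new colour b is made to represent the witness c of x; \<open>e\<close>
      itself does not change.\<close>
    have "sat n rI cI e (block f k g h \<kappa> b (Ex x \<phi>))"
      if adm: "admissible n f k {b..<b + weight (Ex x \<phi>)} (v(b := c)) S \<kappa> E e" for e
    proof -
      have Cb: "color n k (e f) (e (f + 1)) b = residue_class n (e f) c"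
        using adm by (auto simp: admissible_def)
      have "admissible n f k {Suc b..<Suc b + weight \<phi>} v S \<kappa> E e" by (rule admissible_mono[OF adm]) auto
      then have "admissible n f k {Suc b..<Suc b + weight \<phi>} v S (\<kappa>(x \<mapsto> b)) ?E e"
        using Cb unfolding admissible_def by auto
      then have "sat n rI cI e (block f k g h (\<kappa>(x \<mapsto> b)) (Suc b) \<phi>)" by (rule S(3))
      moreover have "c \<in> color n k (e f) (e (f + 1)) b" unfolding Cb using c(1) by (simp add: residue_class_def)
      then have "sat n rI cI (e(f + 6 := c)) (color_fm f k b (f + 6))"
        using sat_color_fm[of "f + 6" f "e(f + 6 := c)" n] c(1) by simp
      ultimately show ?thesis using True c(1) by auto
    qed
    moreover have "card S \<le> weight (Ex x \<phi>)" using S(2) by simp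
    ultimately show ?thesis using S(1) by blast
  next
    case False
    have hh: "sat n rI cI e (h l)" if l: "l \<in> set (pulled \<phi>)" and E: "sat n rI cI ?E l"
      and e: "\<And>v. e v < n" "\<And>y. y \<in> fv l \<Longrightarrow> e y = ?E y" for l e
    proof -
      have "sat n rI cI e l = sat n rI cI ?E l" using e(2) by (rule sat_cong)
      then show ?thesis using "6.prems"(6)[of l e] pulled_subfms[OF l] E e(1) by simp
    qed
    have "\<exists>S v. S \<subseteq> {..<n} \<and> card S \<le> weight \<phi> \<and>
      (\<forall>e. admissible n f k {b..<b + weight \<phi>} v S (\<kappa>(x := None)) ?E e \<longrightarrow>
        sat n rI cI e (block f k h h (\<kappa>(x := None)) b \<phi>))"
    proof (rule "6.IH")
      show "weak_ex y \<phi>" if "y \<in> dom (\<kappa>(x := None))" for y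
        using weak that by auto
      show "sat n rI cI e (h l)" if "l \<in> set (pulled \<phi>)" "sat n rI cI ?E l"
        "\<And>v. e v < n" "\<And>y. y \<in> fv l \<Longrightarrow> e y = ?E y" for l e
        using that by (rule hh)
      show "?E u < n" for u by (rule En)
      show "sat n rI cI ?E \<phi>" by (rule c(2))
    qed (use "6.prems"(1,6) vars in auto)
    then obtain S v where S: "S \<subseteq> {..<n}" "card S \<le> weight \<phi>"
      "\<And>e. admissible n f k {b..<b + weight \<phi>} v S (\<kappa>(x := None)) ?E e \<Longrightarrow>
        sat n rI cI e (block f k h h (\<kappa>(x := None)) b \<phi>)" by blast
    have "sat n rI cI e (block f k g h \<kappa> b (Ex x \<phi>))"
      if adm: "admissible n f k {b..<b + weight (Ex x \<phi>)} v S \<kappa> E e" for e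
    proof -
      have "admissible n f k {b..<b + weight \<phi>} v S \<kappa> E e" by (rule admissible_mono[OF adm]) auto
      \<comment> \<open>A strong variable is really quantified, so its witness is also assigned in
        \<open>e\<close>; q and a are unaffected because \<open>x < f\<close>.\<close>
      then have "admissible n f k {b..<b + weight \<phi>} v S (\<kappa>(x := None)) ?E (e(x := c))"
        using xf c(1) unfolding admissible_def by auto
      then have "sat n rI cI (e(x := c)) (block f k h h (\<kappa>(x := None)) b \<phi>)" by (rule S(3))
      then show ?thesis using False c(1) by auto
    qed
    moreover have "card S \<le> weight (Ex x \<phi>)" using S(2) by simp
    ultimately show ?thesis using S(1) by blast
  qed
next
  case (7 x \<phi>)
  have "sat n rI cI e (g (All x \<phi>))" if adm: "admissible n f k I v S \<kappa> E e" for e I v S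
  proof -
    have "e y = E y" if "y \<in> fv (All x \<phi>)" for y
      using adm that "7.prems"(2) weak_ex_All[OF "7.prems"(4), of y] unfolding admissible_def by auto
    then show ?thesis using "7.prems"(5)[of "All x \<phi>" e] "7.prems"(7) adm by (simp add: admissible_def)
  qed
  then show ?case by (intro exI[of _ "{}"]) simp
qed auto

subsection \<open>Elimination of weak quantifiers\<close>

lemma subfms_vars_weight: "\<theta> \<in> subfms \<phi> \<Longrightarrow> fv \<theta> \<subseteq> fv \<phi> \<union> bound \<phi> \<and> bound \<theta> \<subseteq> bound \<phi> \<and> weight \<theta> \<le> weight \<phi>"
  by (induction \<phi>) auto

lemma wf_subfms: "wf_fm \<tau> \<phi> \<Longrightarrow> \<theta> \<in> subfms \<phi> \<Longrightarrow> wf_fm \<tau> \<theta>"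
  by (induction \<phi>) auto

lemma bound_dual: "bound (dual \<phi>) = bound \<phi>"
  by (induction \<phi>) auto

lemma finite_bound: "finite (bound \<phi>)"
  by (induction \<phi>) auto

lemma finite_strong_bound: "finite (strong_bound \<phi>)"
  by (induction \<phi>) auto

text \<open>The constant 7 consists of the 5 in the rank bound for literals and 2 for q and
  a.\<close>

definition translates :: "sig \<Rightarrow> nat \<Rightarrow> nat \<Rightarrow> fm \<Rightarrow> fm \<Rightarrow> bool" where
  "translates \<tau> f N \<phi> \<phi>' \<longleftrightarrow> wf_fm \<tau> \<phi>' \<and> qr \<phi>' \<le> 3 * strong_qr \<phi> + arity \<tau> + 7 \<and>
     bound \<phi>' \<subseteq> strong_bound \<phi> \<union> {f..<f + 6 + arity \<tau>} \<and>
     (\<forall>n rI cI e. N \<le> n \<longrightarrow> (\<forall>v. e v < n) \<longrightarrow> sat n rI cI e \<phi>' = sat n rI cI e \<phi>)"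

definition coloring_bound :: "nat \<Rightarrow> nat \<Rightarrow> bool" where
  "coloring_bound k N \<longleftrightarrow> (\<forall>n\<ge>N. \<forall>S v. S \<subseteq> {..<n} \<longrightarrow> card S \<le> k \<longrightarrow>
    (\<exists>q a. q < n \<and> a < n \<and> inj_on (\<lambda>x. x mod q) S \<and>
      (\<forall>i<k. color n k q a i = residue_class n q (v i))))"

lemma ex_coloring_bound: "\<exists>N. coloring_bound k N"
proof -
  obtain N where N: "\<forall>n\<ge>N. \<forall>S v. S \<subseteq> {..<n} \<longrightarrow> card S \<le> k \<longrightarrow>
    (\<exists>q a. 0 < q \<and> q < n \<and> a < n \<and> inj_on (\<lambda>x. x mod q) S \<and>
      (\<forall>i<k. Suc i * fact k * q + 1 < n \<and> a mod (Suc i * fact k * q + 1) = v i mod q))"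
    using ex_coloring[of k] by (rule exE)
  have "\<exists>q a. q < n \<and> a < n \<and> inj_on (\<lambda>x. x mod q) S \<and> (\<forall>i<k. color n k q a i = residue_class n q (v i))"
    if prems: "N \<le> n" "S \<subseteq> {..<n}" "card S \<le> k" for n S v
  proof -
    obtain q a where qa: "0 < q" "q < n" "a < n" "inj_on (\<lambda>x. x mod q) S"
      "\<And>i. i < k \<Longrightarrow> Suc i * fact k * q + 1 < n \<and> a mod (Suc i * fact k * q + 1) = v i mod q"
      using N[rule_format, OF prems, of v] by (elim exE conjE) blast
    have "color n k q a i = residue_class n q (v i)" if "i < k" for i
      using color_eq[OF qa(1,3), of i k] qa(5)[OF that] unfolding residue_class_def by simp
    then show ?thesis using qa(2-4) by blast
  qed
  then show ?thesis unfolding coloring_bound_def by blast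
qed

text \<open>Each disjunct guesses a set \<open>F\<close> of pulled subformulas. Their translations
  stand beside the quantifiers for q and a, so ranks are compared by a maximum and not added. A
  subformula outside \<open>F\<close> becomes \<open>false_fm\<close>, which is safe because only
  the implication from replacement to subformula is needed for soundness.\<close>

lemma translate_weak_Ex:
  assumes fin: "finite (srels \<tau>)" and N: "coloring_bound k N"
    and \<psi>: "nnf \<psi>" "wf_fm \<tau> \<psi>" "fv \<psi> \<union> bound \<psi> \<subseteq> {..<f}" "x < f" "weight \<psi> < k" "weak_ex x \<psi>"
    and T: "\<And>l. l \<in> subfms \<psi> \<Longrightarrow> translates \<tau> f N l (T l)"
  shows "\<exists>\<phi>'. translates \<tau> f N (Ex x \<psi>) \<phi>'"
proof -
  let ?g = "\<lambda>F l. if l \<in> set F then true_fm else false_fm"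
  \<comment> \<open>The leading quantifier takes colour 0 and the body starts with colour 1, hence
    the strict bound \<open>weight \<psi> < k\<close>.\<close>
  let ?\<kappa> = "[x \<mapsto> 0::nat]"
  let ?ne = "Ex (f + 6) (color_fm f k 0 (f + 6))"
  let ?block = "\<lambda>F. block f k (?g F) T ?\<kappa> 1 \<psi>"
  let ?\<phi> = "\<lambda>F. Conj (conjs (map T F)) (Ex f (Ex (f + 1) (Conj ?ne (?block F))))"
  let ?\<phi>' = "disjs (map ?\<phi> (subseqs (pulled \<psi>)))"
  have ar: "3 \<le> arity \<tau>" by (rule arity_ge_3[OF fin])
  have sub: "set F \<subseteq> set (pulled \<psi>)" if "F \<in> set (subseqs (pulled \<psi>))" for F
    using that subseqs_powset[of "pulled \<psi>"] by blast
  have subF: "l \<in> subfms \<psi>" if "F \<in> set (subseqs (pulled \<psi>))" "l \<in> set F" for F l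
    using sub[OF that(1)] that(2) pulled_subfms by blast
  have Tl: "wf_fm \<tau> (T l)" "qr (T l) \<le> 3 * strong_qr l + arity \<tau> + 7"
    "bound (T l) \<subseteq> strong_bound l \<union> {f..<f + 6 + arity \<tau>}"
    if "l \<in> subfms \<psi>" for l
    using T[OF that] unfolding translates_def by blast+
  have satT: "sat n rI cI e (T l) = sat n rI cI e l"
    if "l \<in> subfms \<psi>" "N \<le> n" "\<And>v. e v < n" for l n rI cI e
    using T[OF that(1)] that(2,3) unfolding translates_def by blast
  have strong: "strong_qr l \<le> strong_qr \<psi>" "strong_bound l \<subseteq> strong_bound \<psi>" if "l \<in> set (pulled \<psi>)" for l
  proof -
    have "strong_qr l \<le> strong_qr \<psi> \<and> strong_bound l \<subseteq> strong_bound \<psi>"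
      using that by (induction \<psi> rule: pulled.induct) (auto split: if_splits)
    then show "strong_qr l \<le> strong_qr \<psi>" "strong_bound l \<subseteq> strong_bound \<psi>" by auto
  qed
  have "wf_fm \<tau> (?block F)" for F
    by (rule wf_block[OF fin \<psi>(1,2)]) (use Tl(1) in simp)
  then have "wf_fm \<tau> ?\<phi>'" using subF Tl(1) by (auto simp: wf_color_fm)
  moreover have "qr ?\<phi>' \<le> 3 * strong_qr (Ex x \<psi>) + arity \<tau> + 7"
  proof -
    have "qr (?block F) + 2 \<le> 3 * strong_qr \<psi> + arity \<tau> + 7" for F
      by (rule qr_block[OF fin \<psi>(1,2)]) (use Tl(2) in auto)
    then have "qr (Ex f (Ex (f + 1) (Conj ?ne (?block F)))) \<le> 3 * strong_qr \<psi> + arity \<tau> + 7" for F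
      using ar by (simp add: qr_color_fm)
    moreover have "qr (T l) \<le> 3 * strong_qr \<psi> + arity \<tau> + 7"
      if "F \<in> set (subseqs (pulled \<psi>))" "l \<in> set F" for F l
    proof -
      have "strong_qr l \<le> strong_qr \<psi>" using strong(1) sub[OF that(1)] that(2) by blast
      then show ?thesis using Tl(2)[OF subF[OF that]] by linarith
    qed
    ultimately have "qr (?\<phi> F) \<le> 3 * strong_qr \<psi> + arity \<tau> + 7" if "F \<in> set (subseqs (pulled \<psi>))" for F
      using that by (auto simp del: qr.simps simp: qr.simps(3))
    then show ?thesis using \<psi>(6) by auto
  qed
  moreover have "bound ?\<phi>' \<subseteq> strong_bound (Ex x \<psi>) \<union> {f..<f + 6 + arity \<tau>}"
  proof -
    let ?B = "strong_bound \<psi> \<union> {f..<f + 6 + arity \<tau>}"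
    have "bound (?block F) \<subseteq> ?B" for F
      by (rule bound_block[OF fin \<psi>(1,2)]) (use Tl(3) in auto)
    moreover have "bound (color_fm f k 0 (f + 6)) \<subseteq> ?B"
      using bound_color_fm[of f k 0 "f + 6"] by force
    moreover have "f \<in> ?B" "f + 1 \<in> ?B" "f + 6 \<in> ?B" using ar by auto
    moreover have "bound (T l) \<subseteq> ?B" if "F \<in> set (subseqs (pulled \<psi>))" "l \<in> set F" for F l
      using Tl(3)[OF subF[OF that]] strong(2)[of l] sub[OF that(1)] that(2) by blast
    ultimately have "bound (?\<phi> F) \<subseteq> ?B" if "F \<in> set (subseqs (pulled \<psi>))" for F
      unfolding bound.simps bound_disjs_conjs set_map using that by blast
    then have "bound ?\<phi>' \<subseteq> ?B" unfolding bound_disjs_conjs set_map by blast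
    then show ?thesis using \<psi>(6) by simp
  qed
  moreover have "sat n rI cI e ?\<phi>' = sat n rI cI e (Ex x \<psi>)" if n: "N \<le> n" and e: "\<And>v. e v < n" for n rI cI e
  proof
    have fvl: "fv l \<subseteq> {..<f}" if "l \<in> subfms \<psi>" for l
      using subfms_vars_weight[OF that] \<psi>(3) by blast
    assume "sat n rI cI e ?\<phi>'"
    then obtain F where F: "F \<in> set (subseqs (pulled \<psi>))" "sat n rI cI e (?\<phi> F)" by auto
    then obtain q a where qa: "q < n" "a < n" "sat n rI cI (e(f := q, f + 1 := a)) (Conj ?ne (?block F))"
      by auto
    let ?e = "e(f := q, f + 1 := a)"
    have e': "?e v < n" for v using e qa by simp
    have "sat n rI cI e l" if "l \<in> set F" for l
      using F(2) that satT[OF subF[OF F(1) that] n e] by auto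
    moreover have agree: "sat n rI cI ?e l = sat n rI cI e l" if "l \<in> set F" for l
      by (rule sat_cong) (use fvl[OF subF[OF F(1) that]] in auto)
    ultimately have F': "sat n rI cI ?e l" if "l \<in> set F" for l
      using that by blast
    obtain c where c: "c < n" "sat n rI cI (?e(f + 6 := c)) (color_fm f k 0 (f + 6))" using qa(3) by auto
    have ne: "color n k (?e f) (?e (f + 1)) 0 \<noteq> {}"
      using sat_color_fm[of "f + 6" f "?e(f + 6 := c)" n] c by auto
    have "\<exists>v. colored (color n k (?e f) (?e (f + 1))) ?\<kappa> v \<and>
      (\<forall>w. colored (color n k (?e f) (?e (f + 1))) ?\<kappa> w \<longrightarrow> (\<forall>y\<in>real_vars \<psi> \<inter> dom ?\<kappa>. w y = v y) \<longrightarrow>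
        sat n rI cI (override ?\<kappa> w ?e) \<psi>)"
    proof (rule block_sound[OF \<psi>(1,3) e'])
      show "weak_ex y \<psi>" if "y \<in> dom ?\<kappa>" for y using that \<psi>(6) by (auto split: if_splits)
      show "color n k (?e f) (?e (f + 1)) i \<noteq> {}" if "?\<kappa> y = Some i" for y i
        using ne that by (auto split: if_splits)
      show "sat n rI cI ?e l" if "l \<in> set (pulled \<psi>)" "sat n rI cI ?e (?g F l)" for l
        using F'[of l] that(2) by (cases "l \<in> set F") simp_all
      show "sat n rI cI d l" if "l \<in> subfms \<psi>" "\<And>v. d v < n" "sat n rI cI d (T l)" for l d
        using satT[of l n d rI cI, OF that(1) n] that(2,3) by blast
      show "sat n rI cI ?e (?block F)" using qa(3) by simp
    qed
    then obtain v where v: "colored (color n k (?e f) (?e (f + 1))) ?\<kappa> v" "sat n rI cI (override ?\<kappa> v ?e) \<psi>"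
      by blast
    have "v x \<in> color n k (?e f) (?e (f + 1)) 0" using v(1) unfolding colored_def by simp
    then have "v x < n" by (rule color_less)
    moreover have "sat n rI cI (override ?\<kappa> v ?e) \<psi> = sat n rI cI (e(x := v x)) \<psi>"
    proof (rule sat_cong)
      fix y assume "y \<in> fv \<psi>"
      then have "y < f" using \<psi>(3) by auto
      then show "override ?\<kappa> v ?e y = (e(x := v x)) y" by (simp add: override_def)
    qed
    ultimately show "sat n rI cI e (Ex x \<psi>)" using v(2) by auto
  next
    assume "sat n rI cI e (Ex x \<psi>)"
    then obtain c where c: "c < n" "sat n rI cI (e(x := c)) \<psi>" by auto
    \<comment> \<open>The right guess consists of the pulled subformulas true under
      \<open>e\<close>. The witness for x does not affect them, as x is weak and hence not free in
      them.\<close>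
    obtain F where F: "F \<in> set (subseqs (pulled \<psi>))" "set F = {l \<in> set (pulled \<psi>). sat n rI cI e l}"
      using subseqs_powset[of "pulled \<psi>"] by (metis (no_types, lifting) PowI imageE mem_Collect_eq subsetI)
    have "\<exists>S v. S \<subseteq> {..<n} \<and> card S \<le> weight \<psi> \<and>
      (\<forall>d. admissible n f k {1..<1 + weight \<psi>} v S ?\<kappa> (e(x := c)) d \<longrightarrow> sat n rI cI d (?block F))"
    proof (rule block_complete[OF \<psi>(1,3)])
      show "(e(x := c)) v < n" for v using e c(1) by simp
      show "weak_ex y \<psi>" if "y \<in> dom ?\<kappa>" for y using that \<psi>(6) by (auto split: if_splits)
      show "sat n rI cI d (?g F l)" if "l \<in> set (pulled \<psi>)" "sat n rI cI (e(x := c)) l" for l d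
      proof -
        have "x \<notin> fv l" using \<psi>(6) pulled_subfms[OF that(1)] unfolding weak_ex_def by auto
        then have "sat n rI cI e l = sat n rI cI (e(x := c)) l" by (intro sat_cong) auto
        then show ?thesis using that F(2) by simp
      qed
      show "sat n rI cI d (T l)" if "l \<in> subfms \<psi>" "\<And>v. d v < n" "sat n rI cI d l" for l d
        using satT[of l n d rI cI, OF that(1) n] that(2,3) by blast
      show "sat n rI cI (e(x := c)) \<psi>" by (rule c(2))
    qed
    then obtain S v where S: "S \<subseteq> {..<n}" "card S \<le> weight \<psi>"
      "\<And>d. admissible n f k {1..<1 + weight \<psi>} v S ?\<kappa> (e(x := c)) d \<Longrightarrow> sat n rI cI d (?block F)" by blast
    have "card S \<le> k" using S(2) \<psi>(5) by simp
    then obtain q a where qa: "q < n" "a < n" "inj_on (\<lambda>x. x mod q) S"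
      "\<And>i. i < k \<Longrightarrow> color n k q a i = residue_class n q ((v(0 := c)) i)"
      using N n S(1) unfolding coloring_bound_def by blast
    let ?e = "e(f := q, f + 1 := a)"
    have "color n k q a 0 = residue_class n q c" using qa(4)[of 0] \<psi>(5) by simp
    moreover have "color n k q a i = residue_class n q (v i)" if "i \<in> {1..<1 + weight \<psi>}" for i
      using qa(4)[of i] \<psi>(5) that by simp
    ultimately have "admissible n f k {1..<1 + weight \<psi>} v S ?\<kappa> (e(x := c)) ?e"
      unfolding admissible_def using e qa(1-3) by auto
    then have "sat n rI cI ?e (?block F)" by (rule S(3))
    moreover have "c \<in> color n k q a 0" using \<open>color n k q a 0 = _\<close> c(1) by (simp add: residue_class_def)
    then have "sat n rI cI (?e(f + 6 := c)) (color_fm f k 0 (f + 6))"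
      using sat_color_fm[of "f + 6" f "?e(f + 6 := c)" n] c(1) by simp
    then have "sat n rI cI ?e ?ne" using c(1) by auto
    ultimately have "sat n rI cI e (Ex f (Ex (f + 1) (Conj ?ne (?block F))))"
      unfolding sat.simps using qa(1,2) by blast
    moreover have "sat n rI cI e (T l)" if "l \<in> set F" for l
      using satT[of l n e rI cI, OF subF[OF F(1) that] n e] that unfolding F(2) by simp
    ultimately have "sat n rI cI e (?\<phi> F)" by (simp only: sat.simps(3) sat_conjs set_map) blast
    then show "sat n rI cI e ?\<phi>'" unfolding sat_disjs set_map using F(1) by blast
  qed
  ultimately show ?thesis unfolding translates_def by blast
qed

text \<open>The induction is on weight because a universal block passes to the dual of its body,
  which has the same weight without being a subformula. k, N and f stay fixed, so all blocks agree
  on the size threshold and on the fresh names.\<close>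

lemma ex_translates:
  assumes "finite (srels \<tau>)" "coloring_bound k N"
    "nnf \<phi>" "wf_fm \<tau> \<phi>" "fv \<phi> \<union> bound \<phi> \<subseteq> {..<f}" "weight \<phi> \<le> k"
  shows "\<exists>\<phi>'. translates \<tau> f N \<phi> \<phi>'"
  using assms(3-)
proof (induction "weight \<phi>" arbitrary: \<phi> rule: less_induct)
  case less
  have ex_T: "\<exists>T. \<forall>l\<in>subfms \<psi>. translates \<tau> f N l (T l)"
    if "weight \<psi> < weight \<phi>" "nnf \<psi>" "wf_fm \<tau> \<psi>" "fv \<psi> \<union> bound \<psi> \<subseteq> {..<f}" for \<psi>
  proof (rule bchoice, rule ballI)
    fix l assume l: "l \<in> subfms \<psi>"
    show "\<exists>l'. translates \<tau> f N l l'"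
      using subfms_vars_weight[OF l] nnf_subfms[OF that(2) l] wf_subfms[OF that(3) l] that(1,4) less.prems(4)
      by (intro less.hyps) auto
  qed
  show ?case
  proof (cases \<phi>)
    case (Atom a)
    then show ?thesis using less.prems by (intro exI[of _ \<phi>]) (simp add: translates_def)
  next
    case (Neg \<psi>)
    then obtain a where "\<phi> = Neg (Atom a)" using less.prems(1) by (cases \<psi>) auto
    then show ?thesis using less.prems by (intro exI[of _ \<phi>]) (simp add: translates_def)
  next
    case (Conj \<alpha> \<beta>)
    then obtain \<alpha>' \<beta>' where "translates \<tau> f N \<alpha> \<alpha>'" "translates \<tau> f N \<beta> \<beta>'"
      using less.hyps[of \<alpha>] less.hyps[of \<beta>] less.prems weight_ge_2[of \<alpha>] weight_ge_2[of \<beta>] by auto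
    then show ?thesis unfolding Conj
      by (intro exI[of _ "Conj \<alpha>' \<beta>'"]) (auto simp: translates_def max_def)
  next
    case (Disj \<alpha> \<beta>)
    then obtain \<alpha>' \<beta>' where "translates \<tau> f N \<alpha> \<alpha>'" "translates \<tau> f N \<beta> \<beta>'"
      using less.hyps[of \<alpha>] less.hyps[of \<beta>] less.prems weight_ge_2[of \<alpha>] weight_ge_2[of \<beta>] by auto
    then show ?thesis unfolding Disj
      by (intro exI[of _ "Disj \<alpha>' \<beta>'"]) (auto simp: translates_def max_def)
  next
    case (Ex x \<psi>)
    have \<psi>: "nnf \<psi>" "wf_fm \<tau> \<psi>" "fv \<psi> \<union> bound \<psi> \<subseteq> {..<f}" "x < f" "weight \<psi> < weight \<phi>" "weight \<psi> < k"
      using less.prems Ex by auto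
    obtain T where T: "\<And>l. l \<in> subfms \<psi> \<Longrightarrow> translates \<tau> f N l (T l)"
      using ex_T[OF \<psi>(5,1-3)] by blast
    show ?thesis
    proof (cases "weak_ex x \<psi>")
      case True
      then show ?thesis unfolding Ex using translate_weak_Ex[OF assms(1,2) \<psi>(1-4,6)] T by blast
    next
      case False
      then show ?thesis unfolding Ex using T[OF subfms_refl]
        by (intro exI[of _ "Ex x (T \<psi>)"]) (auto simp: translates_def)
    qed
  next
    case (All x \<psi>)
    have \<psi>: "nnf \<psi>" "wf_fm \<tau> \<psi>" "fv \<psi> \<union> bound \<psi> \<subseteq> {..<f}" "x < f" "weight \<psi> < weight \<phi>" "weight \<psi> < k"
      using less.prems All by auto
    show ?thesis
    proof (cases "weak_all x \<psi>")
      case True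
      have d: "nnf (dual \<psi>)" "wf_fm \<tau> (dual \<psi>)" "fv (dual \<psi>) \<union> bound (dual \<psi>) \<subseteq> {..<f}"
        "weight (dual \<psi>) < weight \<phi>" "weight (dual \<psi>) < k" "weak_ex x (dual \<psi>)"
        using \<psi> True by (simp_all add: nnf_dual wf_dual fv_dual bound_dual weight_dual weak_ex_dual)
      obtain T where "\<And>l. l \<in> subfms (dual \<psi>) \<Longrightarrow> translates \<tau> f N l (T l)"
        using ex_T[OF d(4,1-3)] by blast
      then obtain \<chi> where \<chi>: "translates \<tau> f N (Ex x (dual \<psi>)) \<chi>"
        using translate_weak_Ex[OF assms(1,2) d(1-3) \<psi>(4) d(5,6)] by blast
      \<comment> \<open>The result need not be in negation normal form, so a plain negation undoes
        the dualisation.\<close>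
      have "translates \<tau> f N (All x \<psi>) (Neg \<chi>)"
        using \<chi> True d(6) \<psi>(1)
        by (simp add: translates_def strong_qr_dual strong_bound_dual sat_dual)
      then show ?thesis unfolding All by blast
    next
      case False
      obtain T where "\<And>l. l \<in> subfms \<psi> \<Longrightarrow> translates \<tau> f N l (T l)"
        using ex_T[OF \<psi>(5,1-3)] by blast
      then have "translates \<tau> f N \<psi> (T \<psi>)" using subfms_refl by blast
      then show ?thesis unfolding All using False
        by (intro exI[of _ "All x (T \<psi>)"]) (auto simp: translates_def)
    qed
  qed
qed

theorem theorem3p6:
  shows "\<exists>c::nat. \<forall>(\<tau>::sig) \<phi>. finite (srels \<tau>) \<and> wf_fm \<tau> \<phi> \<and> nnf \<phi> \<longrightarrow>
           (\<exists>\<phi>'. wf_fm \<tau> \<phi>' \<and> equiv_fin \<tau> \<phi> \<phi>' \<and>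
                 qr \<phi>' \<le> 3 * strong_qr \<phi> + c * arity \<tau> + c \<and>
                 card (bound \<phi>') \<le> card (strong_bound \<phi>) + c * arity \<tau> + c)"
proof (rule exI[of _ 7], intro allI impI)
  fix \<tau> :: sig and \<phi>
  assume asm: "finite (srels \<tau>) \<and> wf_fm \<tau> \<phi> \<and> nnf \<phi>"
  obtain f where f: "fv \<phi> \<union> bound \<phi> \<subseteq> {..<f}"
    using finite_nat_iff_bounded[of "fv \<phi> \<union> bound \<phi>"] finite_fv finite_bound by auto
  obtain N where N: "coloring_bound (weight \<phi>) N" using ex_coloring_bound by blast
  \<comment> \<open>A positive threshold is needed to repair the finitely many smaller
    sizes.\<close>
  then have "coloring_bound (weight \<phi>) (Suc N)" unfolding coloring_bound_def by (meson Suc_leD)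
  then obtain \<psi> where \<psi>: "translates \<tau> f (Suc N) \<phi> \<psi>"
    using ex_translates[of \<tau> "weight \<phi>" "Suc N" \<phi> f] asm f by blast
  have "\<exists>\<psi>'. wf_fm \<tau> \<psi>' \<and> qr \<psi>' = qr \<psi> \<and> bound \<psi>' = bound \<psi> \<and>
    (\<forall>n rI cI e. 0 < n \<longrightarrow> (\<forall>v. e v < n) \<longrightarrow> sat n rI cI e \<psi>' \<longleftrightarrow> sat n rI cI e \<phi>)"
    by (rule ex_equiv_all_sizes[of "Suc N"]) (use asm \<psi> in \<open>auto simp: translates_def\<close>)
  then obtain \<phi>' where \<phi>': "wf_fm \<tau> \<phi>'" "qr \<phi>' = qr \<psi>" "bound \<phi>' = bound \<psi>"
    "\<And>n rI cI e. 0 < n \<Longrightarrow> \<forall>v. e v < n \<Longrightarrow> sat n rI cI e \<phi>' \<longleftrightarrow> sat n rI cI e \<phi>" by blast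
  have "equiv_fin \<tau> \<phi> \<phi>'" unfolding equiv_fin_def is_struc_def using \<phi>'(4) by auto
  moreover have "qr \<phi>' \<le> 3 * strong_qr \<phi> + 7 * arity \<tau> + 7"
    using \<psi> \<phi>'(2) by (simp add: translates_def)
  moreover have "card (bound \<phi>') \<le> card (strong_bound \<phi>) + 7 * arity \<tau> + 7"
  proof -
    have "card (bound \<phi>') \<le> card (strong_bound \<phi> \<union> {f..<f + 6 + arity \<tau>})"
      using \<psi> \<phi>'(3) by (intro card_mono) (auto simp: translates_def finite_strong_bound)
    also have "\<dots> \<le> card (strong_bound \<phi>) + (6 + arity \<tau>)"
      using card_Un_le[of "strong_bound \<phi>" "{f..<f + 6 + arity \<tau>}"] by simp
    finally show ?thesis by simp
  qed
  ultimately show "\<exists>\<phi>'. wf_fm \<tau> \<phi>' \<and> equiv_fin \<tau> \<phi> \<phi>' \<and> qr \<phi>' \<le> 3 * strong_qr \<phi> + 7 * arity \<tau> + 7 \<and>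
      card (bound \<phi>') \<le> card (strong_bound \<phi>) + 7 * arity \<tau> + 7"
    using \<phi>'(1) by blast
qed

end
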